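(* Let $(G,q_1)$ and $(\Gamma,q_2)$ be metric groups with $|G|$ even, $|\Gamma|$ odd, and $c:=\mathcal{G}(q_1)=-\mathcal{G}(q_2)$; let $K=G_2=\{g\in G:2g=0\}$. Let $S$ be the $J\times J$ matrix defined in the context and let $$N_{i,j,k}=\sum_{w\in J}\frac{S_{w,i}S_{w,j}S_{w,k}}{S_{0,w}}\qquad(i,j,k\in J).$$ Then all the numbers $N_{i,j,k}$ are non-negative integers if and only if $|\Gamma|=|G|+1$ and $K\cong\mathbb{Z}_2\times\mathbb{Z}_2$.
   Context: A metric group $(G,q)$ is a finite abelian group $G$ with a map $q:G\to\mathbb{T}=\{z\in\mathbb{C}:|z|=1\}$ such that $q(-g)=q(g)$ and $\langle g,h\rangle=q(g+h)q(g)^{-1}q(h)^{-1}$ is a non-degenerate bicharacter. $\mathcal{G}(q)=\frac{1}{\sqrt{|G|}}\sum_{g\in G}q(g)$. Let $a=1/\sqrt{|G|}$, $b=1/\sqrt{|\Gamma|}$. Fix $G_*\subset G$, $\Gamma_*\subset\Gamma$ with $G=K\sqcup G_*\sqcup(-G_* )$, $\Gamma=\{0\}\sqcup\Gamma_*\sqcup(-\Gamma_* )$. Let $J_1=(K\setminus\{0\})\times\{1,-1\}$ and $J=\{0,\pi\}\sqcup J_1\sqcup G_*\sqcup\Gamma_*$. With blocks indexed in order by $\{0\},\{\pi\},J_1,G_*,\Gamma_*$ (rows $0,\pi,(k,\varepsilon),g,\gamma$; columns with primes): $$S=\begin{pmatrix} \frac{a-b}{2}&\frac{a+b}{2}&\frac{a}{2}&a&b\\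 \frac{a+b}{2}&\frac{a-b}{2}&\frac{a}{2}&a&-b\\ \frac{a}{2}&\frac{a}{2}&\frac{a\langle k,k'\rangle+c\varepsilon\varepsilon'q_1(k)\delta_{k,k'}}{2}&a\langle k,g'\rangle&0\\ a&a&a\langle g,k'\rangle&a(\langle g,g'\rangle+\overline{\langle g,g'\rangle})&0\\ b&-b&0&0&-b(\langle\gamma,\gamma'\rangle+\overline{\langle\gamma,\gamma'\rangle}) \end{pmatrix}.$$ *)

theory Defs
  imports
    "HOL-Analysis.Analysis"
    "HOL-Library.Numeral_Type"
    "HOL-Library.Product_Plus"
begin

text \<open>Finite abelian groups are types of class \<open>{finite, ab_group_add}\<close>, written additively.\<close>

definition nondegenerate_bicharacter ::
    "('g :: {finite, ab_group_add} \<Rightarrow> 'g \<Rightarrow> complex) \<Rightarrow> bool" where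
  "nondegenerate_bicharacter \<beta> \<longleftrightarrow>
     (\<forall>g h. norm (\<beta> g h) = 1) \<and>
     (\<forall>g g' h. \<beta> (g + g') h = \<beta> g h * \<beta> g' h) \<and>
     (\<forall>g h h'. \<beta> g (h + h') = \<beta> g h * \<beta> g h') \<and>
     (\<forall>g. (\<forall>h. \<beta> g h = 1) \<longrightarrow> g = 0) \<and>
     (\<forall>h. (\<forall>g. \<beta> g h = 1) \<longrightarrow> h = 0)"

definition bichar :: "('g :: {finite, ab_group_add} \<Rightarrow> complex) \<Rightarrow> 'g \<Rightarrow> 'g \<Rightarrow> complex" where
  "bichar q g h = q (g + h) * inverse (q g) * inverse (q h)"

definition metric_group :: "('g :: {finite, ab_group_add} \<Rightarrow> complex) \<Rightarrow> bool" where
  "metric_group q \<longleftrightarrow>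
     (\<forall>g. norm (q g) = 1) \<and> (\<forall>g. q (- g) = q g) \<and> nondegenerate_bicharacter (bichar q)"

definition gauss_sum :: "('g :: {finite, ab_group_add} \<Rightarrow> complex) \<Rightarrow> complex" where
  "gauss_sum q = 1 / complex_of_real (sqrt (real CARD('g))) * (\<Sum>g\<in>UNIV. q g)"

definition two_torsion :: "'g :: {finite, ab_group_add} set" where
  "two_torsion = {g. g + g = 0}"

definition half_system :: "'g :: {finite, ab_group_add} set \<Rightarrow> 'g set \<Rightarrow> bool" where
  "half_system A X \<longleftrightarrow>
     UNIV = A \<union> X \<union> uminus ` X \<and>
     A \<inter> X = {} \<and> A \<inter> uminus ` X = {} \<and> X \<inter> uminus ` X = {}"

text \<open>
  Labels for the rows and columns. The type contains more labels than are used: the actual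
  index set is \<open>index_set Gs \<Gamma>s\<close>, which depends on the chosen half systems \<open>Gs\<close> and \<open>\<Gamma>s\<close>, and
  the sign \<open>\<epsilon>\<close> in \<open>Ix_K k \<epsilon>\<close> ranges over \<open>{1, -1}\<close> there.
\<close>

datatype ('g, 'h) index = Ix_0 | Ix_pi | Ix_K 'g int | Ix_G 'g | Ix_\<Gamma> 'h

definition index_set ::
    "'g :: {finite, ab_group_add} set \<Rightarrow> 'h :: {finite, ab_group_add} set \<Rightarrow> ('g, 'h) index set" where
  "index_set Gs \<Gamma>s =
     {Ix_0, Ix_pi} \<union> {Ix_K k \<epsilon> | k \<epsilon>. k \<in> two_torsion - {0} \<and> \<epsilon> \<in> {1, -1}} \<union> Ix_G ` Gs \<union> Ix_\<Gamma> ` \<Gamma>s"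

definition S_matrix ::
    "complex \<Rightarrow> ('g :: {finite, ab_group_add} \<Rightarrow> complex) \<Rightarrow> ('h :: {finite, ab_group_add} \<Rightarrow> complex) \<Rightarrow>
     ('g, 'h) index \<Rightarrow> ('g, 'h) index \<Rightarrow> complex" where
  "S_matrix c q1 q2 i j =
     (let a = 1 / complex_of_real (sqrt (real CARD('g)));
          b = 1 / complex_of_real (sqrt (real CARD('h)))
      in case i of
        Ix_0 \<Rightarrow> (case j of
            Ix_0 \<Rightarrow> (a - b) / 2
          | Ix_pi \<Rightarrow> (a + b) / 2
          | Ix_K k' \<epsilon>' \<Rightarrow> a / 2
          | Ix_G g' \<Rightarrow> a
          | Ix_\<Gamma> \<gamma>' \<Rightarrow> b)
      | Ix_pi \<Rightarrow> (case j of
            Ix_0 \<Rightarrow> (a + b) / 2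
          | Ix_pi \<Rightarrow> (a - b) / 2
          | Ix_K k' \<epsilon>' \<Rightarrow> a / 2
          | Ix_G g' \<Rightarrow> a
          | Ix_\<Gamma> \<gamma>' \<Rightarrow> - b)
      | Ix_K k \<epsilon> \<Rightarrow> (case j of
            Ix_0 \<Rightarrow> a / 2
          | Ix_pi \<Rightarrow> a / 2
          | Ix_K k' \<epsilon>' \<Rightarrow>
              (a * bichar q1 k k' + c * of_int \<epsilon> * of_int \<epsilon>' * q1 k * of_bool (k = k')) / 2
          | Ix_G g' \<Rightarrow> a * bichar q1 k g'
          | Ix_\<Gamma> \<gamma>' \<Rightarrow> 0)
      | Ix_G g \<Rightarrow> (case j of
            Ix_0 \<Rightarrow> a
          | Ix_pi \<Rightarrow> a
          | Ix_K k' \<epsilon>' \<Rightarrow> a * bichar q1 g k'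
          | Ix_G g' \<Rightarrow> a * (bichar q1 g g' + cnj (bichar q1 g g'))
          | Ix_\<Gamma> \<gamma>' \<Rightarrow> 0)
      | Ix_\<Gamma> \<gamma> \<Rightarrow> (case j of
            Ix_0 \<Rightarrow> b
          | Ix_pi \<Rightarrow> - b
          | Ix_K k' \<epsilon>' \<Rightarrow> 0
          | Ix_G g' \<Rightarrow> 0
          | Ix_\<Gamma> \<gamma>' \<Rightarrow> - b * (bichar q2 \<gamma> \<gamma>' + cnj (bichar q2 \<gamma> \<gamma>'))))"

text \<open>The Verlinde-type sum; \<open>z\<close> is the distinguished label \<open>0\<close> of \<open>J\<close>.\<close>

definition N_coeff ::
    "'i set \<Rightarrow> ('i \<Rightarrow> 'i \<Rightarrow> complex) \<Rightarrow> 'i \<Rightarrow> 'i \<Rightarrow> 'i \<Rightarrow> 'i \<Rightarrow> complex" where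
  "N_coeff J S z i j k = (\<Sum>w\<in>J. S w i * S w j * S w k / S z w)"

end

(* The matrix S comes from the characters of G and Gamma, symmetrised under inversion. In the columns
   X_g (g in G), Y_y (y in Gamma) and D_k (k in K) defined below, those of S are
     0 = (X_0 - Y_0)/2,  pi = (X_0 + Y_0)/2,  (k,eps) = (X_k + eps D_k)/2,  g = X_g,  gamma = Y_gamma,
   and the trilinear form sum_w u_w v_w t_w / S_{0,w} takes simple values on them: with d = |Gamma| - |G|
   and n(g,h,l) the number of vanishing sums g +- h +- l, it is 4/d + n on XXX, 4/d on XXY and XYY,
   4/d - n on YYY, 4 c^2 <k, k+g> on X_g D_k D_k, and 0 otherwise.

   Integrality on the labels (k,+-) forces d = 1, c^2 = 1 and k + k' + k'' = 0 for distinct nonzero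
   k, k', k'' in K, so |K| is 2 or 4. Conversely, for |K| = 4, d = 1, c^2 = 1 all values are visibly
   non-negative integers. What remains is arithmetic of Gauss sums: |K| = 2 excludes c^2 = 1, while
   |K| = 4 and d = 1 give c^2 = 1. Both follow by taking determinants in the Weil representation relation
   S T S = c T^-1 (S^-1) T^-1, with S the Fourier matrix and T = diag(q), on all functions and on odd functions:
   (-1)^m prod_G q^6 = c^(2|G|) and (-1)^m prod_{G*} q^6 = c^(2m), where m = |G*|. *)

theory Submission
  imports Defs
begin

section \<open>Metric groups and half systems\<close>

lemma half_system_card:
  fixes A X :: "'g :: {finite, ab_group_add} set"
  assumes "half_system A X"
  shows "CARD('g) = card A + 2 * card X"
proof -
  have U: "UNIV = A \<union> (X \<union> uminus ` X)" and d: "A \<inter> (X \<union> uminus ` X) = {}" "X \<inter> uminus ` X = {}"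
    using assms unfolding half_system_def by blast+
  have "CARD('g) = card A + card (X \<union> uminus ` X)"
    by (subst U, rule card_Un_disjoint) (use d in auto)
  also have "card (X \<union> uminus ` X) = card X + card (uminus ` X)"
    by (rule card_Un_disjoint) (use d in auto)
  also have "card (uminus ` X) = card X"
    by (rule card_image) (simp add: inj_on_def)
  finally show ?thesis by simp
qed

lemma half_system_sum:
  fixes f :: "'g :: {finite, ab_group_add} \<Rightarrow> complex"
  assumes "half_system A X" and ev: "\<And>x. f (- x) = f x"
  shows "(\<Sum>x\<in>UNIV. f x) = (\<Sum>x\<in>A. f x) + 2 * (\<Sum>x\<in>X. f x)"
proof -
  have U: "UNIV = A \<union> (X \<union> uminus ` X)" and d: "A \<inter> (X \<union> uminus ` X) = {}" "X \<inter> uminus ` X = {}"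
    using assms unfolding half_system_def by blast+
  have "sum f UNIV = sum f A + sum f (X \<union> uminus ` X)"
    by (subst U, rule sum.union_disjoint) (use d in auto)
  also have "sum f (X \<union> uminus ` X) = sum f X + sum f (uminus ` X)"
    by (rule sum.union_disjoint) (use d in auto)
  also have "sum f (uminus ` X) = sum f X"
    by (subst sum.reindex) (auto simp: inj_on_def ev)
  finally show ?thesis by simp
qed

lemma half_system_prod:
  fixes f :: "'g :: {finite, ab_group_add} \<Rightarrow> complex"
  assumes "half_system A X" and ev: "\<And>x. f (- x) = f x"
  shows "(\<Prod>x\<in>UNIV. f x) = (\<Prod>x\<in>A. f x) * (\<Prod>x\<in>X. f x)\<^sup>2"
proof -
  have U: "UNIV = A \<union> (X \<union> uminus ` X)" and d: "A \<inter> (X \<union> uminus ` X) = {}" "X \<inter> uminus ` X = {}"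
    using assms unfolding half_system_def by blast+
  have "prod f UNIV = prod f A * prod f (X \<union> uminus ` X)"
    by (subst U, rule prod.union_disjoint) (use d in auto)
  also have "prod f (X \<union> uminus ` X) = prod f X * prod f (uminus ` X)"
    by (rule prod.union_disjoint) (use d in auto)
  also have "prod f (uminus ` X) = prod f X"
    by (subst prod.reindex) (auto simp: inj_on_def ev)
  finally show ?thesis by (simp add: power2_eq_square)
qed

lemma half_system_cases:
  assumes "half_system A X"
  obtains "x \<in> A" | "x \<in> X" | "- x \<in> X"
proof -
  have U: "UNIV = A \<union> X \<union> uminus ` X"
    using assms unfolding half_system_def by (rule conjunct1)
  have "x \<in> A \<union> X \<union> uminus ` X"
    unfolding U[symmetric] by (rule UNIV_I)
  then show ?thesis
  proof (elim UnE imageE)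
    fix y assume "x = - y" "y \<in> X"
    then show ?thesis using that(3) by simp
  qed (use that in simp_all)
qed

lemma half_system_notin:
  assumes "half_system A X" "x \<in> X"
  shows "x \<notin> A" "- x \<notin> A" "- x \<notin> X"
proof -
  have d: "A \<inter> X = {}" "A \<inter> uminus ` X = {}" "X \<inter> uminus ` X = {}"
    using assms(1) unfolding half_system_def by simp_all
  have "- x \<in> uminus ` X" using assms(2) by (rule imageI)
  then show "x \<notin> A" "- x \<notin> A" "- x \<notin> X"
    using d assms(2) by (meson disjoint_iff)+
qed

text \<open>An element with \<open>- x = x\<close> cannot lie in \<open>X\<close>, which is disjoint
  from its negative. This makes the Gauss sum identities for
  \<open>half_system two_torsion X\<close> available for the group of odd order.\<close>

lemma half_system_trivial_torsion:
  fixes X :: "'g :: {finite, ab_group_add} set"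
  assumes "half_system {0} X"
  shows "two_torsion = {0 :: 'g}"
proof -
  have "x = 0" if "x + x = 0" for x :: 'g
  proof -
    have m: "- x = x" using that by (simp add: add_eq_0_iff)
    show ?thesis
      using assms
    proof (cases rule: half_system_cases[where x = x])
      case 2
      then show ?thesis using half_system_notin(3)[OF assms 2] unfolding m by contradiction
    next
      case 3
      then show ?thesis using half_system_notin(3)[OF assms 3] unfolding m by simp
    qed simp
  qed
  then have "two_torsion \<subseteq> {0 :: 'g}" unfolding two_torsion_def by blast
  then show ?thesis by (auto simp: two_torsion_def)
qed

section \<open>Characters and Gauss sums of a metric group\<close>

locale metric_group_loc =
  fixes q :: "'g :: {finite, ab_group_add} \<Rightarrow> complex"
  assumes mg: "metric_group q"
begin

abbreviation e where "e \<equiv> bichar q"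

lemma norm_q [simp]: "norm (q g) = 1" and q_minus [simp]: "q (- g) = q g"
  using mg by (auto simp: metric_group_def)

lemma q_nonzero [simp]: "q g \<noteq> 0"
  using norm_q[of g] by (metis norm_zero zero_neq_one)

lemma norm_e [simp]: "norm (e g h) = 1"
  and e_add_left: "e (g + g') h = e g h * e g' h"
  and e_add_right: "e g (h + h') = e g h * e g h'"
  using mg unfolding metric_group_def nondegenerate_bicharacter_def by auto

lemma e_nondegenerate: "(\<And>h. e g h = 1) \<Longrightarrow> g = 0"
  using mg unfolding metric_group_def nondegenerate_bicharacter_def by auto

lemma e_nonzero [simp]: "e g h \<noteq> 0"
  using norm_e[of g h] by (metis norm_zero zero_neq_one)

lemma e_commute: "e g h = e h g"
  by (simp add: bichar_def add.commute mult.commute)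

lemma e_zero [simp]: "e 0 h = 1" "e h 0 = 1"
  using e_add_left[of 0 0 h] e_add_right[of h 0 0] by auto

lemma e_cnj: "cnj (e g h) = inverse (e g h)"
proof -
  have "e g h * cnj (e g h) = 1" by (simp add: complex_norm_square[symmetric])
  then show ?thesis by (simp add: inverse_unique)
qed

lemma e_minus: "e (- g) h = cnj (e g h)" "e g (- h) = cnj (e g h)"
proof -
  have "e g h * e (- g) h = 1" "e g h * e g (- h) = 1"
    using e_add_left[of g "-g" h] e_add_right[of g h "-h"] by auto
  from this[THEN inverse_unique] show "e (- g) h = cnj (e g h)" "e g (- h) = cnj (e g h)"
    unfolding e_cnj by auto
qed

lemma q_zero [simp]: "q 0 = 1"
  using e_zero(1)[of 0] by (simp add: bichar_def)

lemma q_add: "q (g + h) = q g * q h * e g h"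
  by (simp add: bichar_def field_simps)

lemma e_self: "e g g = (q g)\<^sup>2"
proof -
  have "e g (- g) = inverse (q g ^ 2)"
    by (simp add: bichar_def power2_eq_square)
  then show ?thesis by (simp add: e_minus e_cnj)
qed

lemma e_torsion_square: "g \<in> two_torsion \<Longrightarrow> e g h ^ 2 = 1"
  using e_add_left[of g g h] by (simp add: two_torsion_def power2_eq_square)

lemma e_torsion_cases: "g \<in> two_torsion \<Longrightarrow> e g h = 1 \<or> e g h = - 1"
  using e_torsion_square power2_eq_1_iff by blast

lemma e_torsion_cnj: "g \<in> two_torsion \<Longrightarrow> cnj (e g h) = e g h"
  using e_torsion_cases[of g h] by auto

text \<open>Orthogonality of characters: translating by some \<open>h\<close> with
  \<open>e g h\<close> different from 1 multiplies the sum by \<open>e g h\<close>, so the sum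
  vanishes for nonzero \<open>g\<close>.\<close>

lemma e_sum: "(\<Sum>x\<in>UNIV. e g x) = of_nat CARD('g) * of_bool (g = 0)"
proof (cases "g = 0")
  case False
  then obtain h where h: "e g h \<noteq> 1" using e_nondegenerate by blast
  have "(\<Sum>x\<in>UNIV. e g x) = (\<Sum>x\<in>UNIV. e g (h + x))"
    by (rule sum.reindex_bij_witness[of _ "\<lambda>x. h + x" "\<lambda>x. x - h"]) auto
  also have "\<dots> = e g h * (\<Sum>x\<in>UNIV. e g x)"
    by (simp add: e_add_right sum_distrib_left)
  finally show ?thesis using h False by simp
qed simp

text \<open>The product of all \<open>e x h\<close> is nonzero, and translating \<open>x\<close> by
  \<open>g\<close> multiplies it by the power in question.\<close>

lemma e_power_card: "e g h ^ CARD('g) = 1"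
proof -
  have "(\<Prod>x\<in>UNIV. e x h) = (\<Prod>x\<in>UNIV. e (g + x) h)"
    by (rule prod.reindex_bij_witness[of _ "\<lambda>x. g + x" "\<lambda>x. x - g"]) auto
  also have "\<dots> = e g h ^ CARD('g) * (\<Prod>x\<in>UNIV. e x h)"
    by (simp add: e_add_left prod.distrib)
  finally show ?thesis by simp
qed

text \<open>Completing the square: up to the factor \<open>q x\<close>, the summand is
  \<open>q (y + x)\<close>. This identity is the source of the Weil representation relation.\<close>

lemma gauss_translate:
  "(\<Sum>y\<in>UNIV. q y * e y x) = complex_of_real (sqrt CARD('g)) * gauss_sum q * inverse (q x)"
proof -
  have "(\<Sum>y\<in>UNIV. q y) = (\<Sum>y\<in>UNIV. q (y + x))"
    by (rule sum.reindex_bij_witness[of _ "\<lambda>y. y + x" "\<lambda>y. y - x"]) auto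
  also have "\<dots> = (\<Sum>y\<in>UNIV. q y * e y x) * q x"
    by (simp add: q_add sum_distrib_left mult_ac)
  finally show ?thesis by (simp add: gauss_sum_def field_simps)
qed

end

section \<open>Determinants of the Weil representation\<close>

text \<open>\<open>det\<close> takes matrices indexed by a whole type. Padding by the identity
  outside \<open>X\<close> turns a matrix on \<open>X\<close> into one of that shape with the same
  determinant and compatible products.\<close>

definition block_matrix :: "'n set \<Rightarrow> ('n \<Rightarrow> 'n \<Rightarrow> complex) \<Rightarrow> complex ^ 'n ^ 'n :: finite" where
  "block_matrix X A = (\<chi> i j. if i \<in> X \<and> j \<in> X then A i j else of_bool (i = j))"

lemma block_matrix_mult:
  "block_matrix X A ** block_matrix X B = block_matrix X (\<lambda>i j. \<Sum>l\<in>X. A i l * B l j)"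
proof -
  have "(\<Sum>l\<in>UNIV. block_matrix X A $ i $ l * block_matrix X B $ l $ j) =
      block_matrix X (\<lambda>i j. \<Sum>l\<in>X. A i l * B l j) $ i $ j" (is "?L = _") for i j
  proof (cases "i \<in> X")
    case i: True
    have "?L = (\<Sum>l\<in>X. A i l * block_matrix X B $ l $ j)"
      using i by (intro sum.mono_neutral_cong_right) (auto simp: block_matrix_def)
    also have "\<dots> = block_matrix X (\<lambda>i j. \<Sum>l\<in>X. A i l * B l j) $ i $ j"
      using i by (cases "j \<in> X") (auto simp: block_matrix_def intro!: sum.neutral)
    finally show ?thesis .
  next
    case False
    then have "?L = (\<Sum>l\<in>{i}. block_matrix X B $ l $ j)"
      by (intro sum.mono_neutral_cong_right) (auto simp: block_matrix_def)
    with False show ?thesis by (simp add: block_matrix_def)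
  qed
  then show ?thesis by (simp add: matrix_matrix_mult_def vec_eq_iff)
qed

lemma block_matrix_cong:
  "(\<And>i j. i \<in> X \<Longrightarrow> j \<in> X \<Longrightarrow> A i j = B i j) \<Longrightarrow> block_matrix X A = block_matrix X B"
  by (simp add: block_matrix_def vec_eq_iff)

lemma det_block_matrix_diagonal:
  fixes X :: "'n :: finite set"
  shows "det (block_matrix X (\<lambda>i j. if i = j then t i else 0)) = (\<Prod>i\<in>X. t i)"
proof -
  have "det (block_matrix X (\<lambda>i j. if i = j then t i else 0)) = (\<Prod>i\<in>UNIV. if i \<in> X then t i else 1)"
    by (subst det_diagonal) (auto simp: block_matrix_def intro!: prod.cong)
  also have "\<dots> = (\<Prod>i\<in>X. t i)"
    by (intro prod.mono_neutral_cong_right) auto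
  finally show ?thesis .
qed

text \<open>With n = \<open>card X\<close> and a, j, P the determinants of \<open>A\<close>,
  \<open>J\<close> and diag(\<open>t\<close>), the second relation gives a P a = c^n j a / P^2,
  hence P^3 a = c^n j. Squaring and inserting a^2 = j eliminates the determinant of the Fourier
  matrix, of which only the square is known. For a Fourier matrix \<open>J\<close> is inversion, and
  \<open>J\<close> times \<open>A\<close> is the inverse of \<open>A\<close>.\<close>

lemma det_braid_relation:
  fixes X :: "'n :: finite set" and A J :: "'n \<Rightarrow> 'n \<Rightarrow> complex" and t :: "'n \<Rightarrow> complex"
  assumes AA: "\<And>x z. x \<in> X \<Longrightarrow> z \<in> X \<Longrightarrow> (\<Sum>y\<in>X. A x y * A y z) = J x z"
    and ATA: "\<And>x z. x \<in> X \<Longrightarrow> z \<in> X \<Longrightarrow>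
      (\<Sum>y\<in>X. A x y * (t y * A y z)) =
        c * inverse (t x) * ((\<Sum>y\<in>X. J x y * A y z) * inverse (t z))"
    and t: "\<And>x. x \<in> X \<Longrightarrow> t x \<noteq> 0"
    and J: "det (block_matrix X J) \<noteq> 0"
  shows "(\<Prod>x\<in>X. t x) ^ 6 = c ^ (2 * card X) * det (block_matrix X J)"
proof -
  let ?B = "block_matrix X" and ?D = "\<lambda>f i j. if i = j then f i else 0"
  define P a j where "P = (\<Prod>x\<in>X. t x)" and "a = det (?B A)" and "j = det (?B J)"
  have P: "P \<noteq> 0" unfolding P_def using t by simp
  have "?B A ** ?B A = ?B J"
    unfolding block_matrix_mult by (rule block_matrix_cong) (rule AA)
  from arg_cong[OF this, of det] have aj: "a * a = j" by (simp add: det_mul a_def j_def)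
  have "?B A ** (?B (?D t) ** ?B A) =
      ?B (?D (\<lambda>x. c * inverse (t x))) ** ((?B J ** ?B A) ** ?B (?D (\<lambda>x. inverse (t x))))"
    unfolding block_matrix_mult
    by (rule block_matrix_cong) (simp add: if_distrib[of "\<lambda>x. x * _"] if_distrib[of "\<lambda>x. _ * x"] ATA cong: if_cong)
  from arg_cong[OF this, of det]
  have "a * (P * a) = (c ^ card X * inverse P) * ((j * a) * inverse P)"
    by (simp add: det_mul det_block_matrix_diagonal a_def j_def P_def prod.distrib prod_inversef[symmetric])
  then have "a * (P ^ 3 * a) = a * (c ^ card X * j)"
    using P by (simp add: field_simps power3_eq_cube)
  moreover have "a \<noteq> 0" using aj J by (auto simp: j_def)
  ultimately have "(P ^ 3 * a)\<^sup>2 = (c ^ card X * j)\<^sup>2" by simp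
  moreover have "(P ^ 3 * a)\<^sup>2 = P ^ 6 * j"
    by (simp add: power_mult_distrib power_mult[symmetric] aj[symmetric] power2_eq_square[of a])
  moreover have "(c ^ card X * j)\<^sup>2 = c ^ (2 * card X) * j * j"
    by (simp add: power_mult_distrib power_even_eq power2_eq_square[of j])
  ultimately have "P ^ 6 * j = c ^ (2 * card X) * j * j" by simp
  then show ?thesis using J by (simp add: P_def j_def)
qed

section \<open>The sign of inversion as a permutation\<close>

lemma permutation_negation_part:
  fixes X :: "'g :: {finite, ab_group_add} set"
  assumes "X \<inter> uminus ` X = {}"
  shows "(\<lambda>x. if x \<in> X \<union> uminus ` X then - x else x) permutes UNIV"
  unfolding permutes_def
proof (intro conjI allI)
  fix y
  show "\<exists>!x. (if x \<in> X \<union> uminus ` X then - x else x) = y"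
  proof (cases "y \<in> X \<union> uminus ` X")
    case True
    then have "- y \<in> X \<union> uminus ` X" by force
    then show ?thesis using True by (intro ex1I[of _ "- y"]) (auto split: if_splits)
  next
    case False
    then show ?thesis
      by (intro ex1I[of _ y]) (auto split: if_splits simp: image_iff)
  qed
qed simp

text \<open>Negation on \<open>X\<close> and its mirror image is a product of \<open>card X\<close>
  disjoint transpositions. Negating only part of the group allows induction on \<open>X\<close>:
  each new element contributes the transposition of \<open>x\<close> and \<open>- x\<close>.\<close>

lemma sign_negation_part:
  fixes X :: "'g :: {finite, ab_group_add} set"
  assumes "X \<inter> uminus ` X = {}"
  shows "sign (\<lambda>x. if x \<in> X \<union> uminus ` X then - x else x) = (- 1) ^ card X"
proof -
  have "finite X" by simp
  then show ?thesis using assms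
  proof (induction X)
    case empty
    then show ?case by simp
  next
    case (insert x X)
    let ?p = "\<lambda>X x. if x \<in> X \<union> uminus ` X then - x else x :: 'g"
    have d: "X \<inter> uminus ` X = {}" and nx: "x \<noteq> - x" and x: "x \<notin> uminus ` X" "- x \<notin> X"
      using insert.prems by auto
    have x': "x \<notin> X" "- x \<notin> uminus ` X" using insert.hyps by auto
    have "?p (insert x X) = Transposition.transpose x (- x) \<circ> ?p X"
    proof
      fix y
      consider "y = x" | "y = - x" | "y \<noteq> x" "y \<noteq> - x" by blast
      then show "?p (insert x X) y = (Transposition.transpose x (- x) \<circ> ?p X) y"
      proof cases
        case 3
        then have "- y \<noteq> x" "- y \<noteq> - x" by auto
        with 3 show ?thesis by (auto simp: transpose_def)
      qed (use x x' nx in \<open>auto simp: transpose_def\<close>)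
    qed
    moreover have "permutation (?p X)"
      by (rule permutes_imp_permutation[OF _ permutation_negation_part[OF d]]) simp
    ultimately have "sign (?p (insert x X)) = - sign (?p X)"
      using nx by (simp add: sign_compose permutation_swap_id sign_swap_id)
    then show ?case using insert.IH[OF d] insert.hyps by simp
  qed
qed

lemma sign_uminus:
  fixes X :: "'g :: {finite, ab_group_add} set"
  assumes hs: "half_system two_torsion X"
  shows "sign (uminus :: 'g \<Rightarrow> 'g) = (- 1) ^ card X" "(uminus :: 'g \<Rightarrow> 'g) permutes UNIV"
proof -
  have d: "X \<inter> uminus ` X = {}" using hs unfolding half_system_def by simp
  have "(if x \<in> X \<union> uminus ` X then - x else x) = - x" for x
    using hs
  proof (cases rule: half_system_cases[where x = x])
    case 1
    then have "- x = x" by (simp add: two_torsion_def add_eq_0_iff)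
    then show ?thesis by simp
  next
    case 3
    then have "x \<in> uminus ` X" by force
    then show ?thesis by simp
  qed simp
  then have eq: "(\<lambda>x. if x \<in> X \<union> uminus ` X then - x else x) = uminus" by auto
  show "sign (uminus :: 'g \<Rightarrow> 'g) = (- 1) ^ card X" "(uminus :: 'g \<Rightarrow> 'g) permutes UNIV"
    using sign_negation_part[OF d] permutation_negation_part[OF d] unfolding eq by auto
qed

section \<open>Gauss sum identities from the Weil representation\<close>

context metric_group_loc
begin

lemma sqrt_card:
  "complex_of_real (sqrt (real CARD('g))) * complex_of_real (sqrt (real CARD('g))) = of_nat CARD('g)"
  "complex_of_real (sqrt (real CARD('g))) \<noteq> 0"
proof -
  have "sqrt (real CARD('g)) * sqrt (real CARD('g)) = real CARD('g)" by simp
  then show "complex_of_real (sqrt (real CARD('g))) * complex_of_real (sqrt (real CARD('g))) = of_nat CARD('g)"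
    by (metis of_real_mult of_real_of_nat_eq)
qed simp

text \<open>\<open>?A\<close> is the Fourier matrix. By orthogonality its square is the permutation
  matrix of inversion, whose determinant is the sign of inversion; the second relation is
  \<open>gauss_translate\<close> at \<open>x + z\<close>.\<close>

lemma gauss_sum_power_full:
  fixes X :: "'g set"
  assumes hs: "half_system two_torsion X"
  shows "(\<Prod>x\<in>UNIV. q x) ^ 6 = gauss_sum q ^ (2 * CARD('g)) * (- 1) ^ card X"
proof -
  let ?r = "complex_of_real (sqrt (real CARD('g)))"
  let ?A = "\<lambda>x y. e x y / ?r" and ?J = "\<lambda>x z :: 'g. of_bool (x = - z) :: complex"
  have "block_matrix UNIV ?J = (\<chi> i. mat 1 $ (- i))"
    by (auto simp: block_matrix_def mat_def vec_eq_iff)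
  then have "det (block_matrix UNIV ?J) = of_int (sign (uminus :: 'g \<Rightarrow> 'g))"
    using det_permute_rows[OF sign_uminus(2)[OF hs], of "mat 1"] by simp
  then have dJ: "det (block_matrix UNIV ?J) = (- 1) ^ card X"
    by (simp add: sign_uminus(1)[OF hs])
  have "(\<Prod>x\<in>UNIV. q x) ^ 6 = gauss_sum q ^ (2 * CARD('g)) * det (block_matrix UNIV ?J)"
  proof (rule det_braid_relation[where A = ?A])
    fix x z :: 'g
    have "(\<Sum>y\<in>UNIV. ?A x y * ?A y z) = (\<Sum>y\<in>UNIV. e (x + z) y) / (?r * ?r)"
      by (simp add: e_add_left sum_divide_distrib e_commute[of _ z])
    also have "\<dots> = ?J x z"
      by (simp only: e_sum sqrt_card) (simp add: add_eq_0_iff2)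
    finally show "(\<Sum>y\<in>UNIV. ?A x y * ?A y z) = ?J x z" .
    have "(\<Sum>y\<in>UNIV. ?A x y * (q y * ?A y z)) = (\<Sum>y\<in>UNIV. q y * e y (x + z)) / (?r * ?r)"
      by (simp add: e_add_right sum_divide_distrib e_commute[of x] mult_ac)
    also have "\<dots> = gauss_sum q * inverse (q x) * (e (- x) z / ?r * inverse (q z))"
      unfolding gauss_translate by (simp add: q_add e_minus e_cnj field_simps sqrt_card)
    also have "e (- x) z / ?r = (\<Sum>y\<in>{- x}. ?J x y * ?A y z)" by simp
    also have "\<dots> = (\<Sum>y\<in>UNIV. ?J x y * ?A y z)"
      by (rule sum.mono_neutral_left) auto
    finally show "(\<Sum>y\<in>UNIV. ?A x y * (q y * ?A y z)) =
      gauss_sum q * inverse (q x) * ((\<Sum>y\<in>UNIV. ?J x y * ?A y z) * inverse (q z))" .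
  qed (simp_all add: dJ)
  then show ?thesis by (simp add: dJ)
qed

text \<open>On odd functions the square of the Fourier matrix, which is inversion, acts as -1.\<close>

lemma gauss_sum_power_odd:
  fixes X :: "'g set"
  assumes hs: "half_system two_torsion X"
  shows "(\<Prod>x\<in>X. q x) ^ 6 = gauss_sum q ^ (2 * card X) * (- 1) ^ card X"
proof -
  let ?r = "complex_of_real (sqrt (real CARD('g)))"
  \<comment> \<open>An odd function vanishes on the 2-torsion and is determined by its values on
    \<open>X\<close>; in these coordinates the Fourier transform has the kernel
    \<open>?A\<close>.\<close>
  let ?A = "\<lambda>x y. (e x y - cnj (e x y)) / ?r"
    and ?J = "\<lambda>x z :: 'g. if x = z then - 1 else 0 :: complex"
  have dJ: "det (block_matrix X ?J) = (- 1) ^ card X"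
    by (simp add: det_block_matrix_diagonal)
  have A_odd: "?A x (- y) = - ?A x y" "?A (- y) x = - ?A y x" for x y
    by (simp_all add: e_minus diff_divide_distrib)
  \<comment> \<open>Both factors \<open>?A\<close> are odd in \<open>y\<close>, so the summand is
    even, and it vanishes on the 2-torsion, where \<open>e\<close> is real.\<close>
  have half: "(\<Sum>y\<in>X. f y * (?A x y * ?A y z)) = (\<Sum>y\<in>UNIV. f y * (?A x y * ?A y z)) / 2"
    if "\<And>y. f (- y) = f y" for f x z
  proof -
    have "(\<Sum>y\<in>two_torsion. f y * (?A x y * ?A y z)) = 0"
      by (rule sum.neutral) (simp add: e_torsion_cnj)
    moreover have "(\<Sum>y\<in>UNIV. f y * (?A x y * ?A y z)) =
        (\<Sum>y\<in>two_torsion. f y * (?A x y * ?A y z)) + 2 * (\<Sum>y\<in>X. f y * (?A x y * ?A y z))"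
      using hs by (rule half_system_sum) (simp only: A_odd that, simp)
    ultimately show ?thesis by simp
  qed
  have AA: "?A x y * ?A y z = (e y (x + z) - e y (x - z) - e y (z - x) + e y (- x - z)) / (?r * ?r)" for x y z
  proof -
    have s: "e y (x + z) = e x y * e y z" "e y (x - z) = e x y * cnj (e y z)"
      "e y (z - x) = cnj (e x y) * e y z" "e y (- x - z) = cnj (e x y) * cnj (e y z)"
      using e_add_right[of y x z] e_add_right[of y x "- z"] e_add_right[of y z "- x"]
        e_add_right[of y "- x" "- z"]
      by (simp_all add: e_minus e_commute[of y x])
    show ?thesis unfolding s times_divide_times_eq by (simp only: ring_distribs) (simp add: algebra_simps)
  qed
  have "(\<Prod>x\<in>X. q x) ^ 6 = gauss_sum q ^ (2 * card X) * det (block_matrix X ?J)"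
  proof (rule det_braid_relation[where A = ?A])
    fix x z assume xz: "x \<in> X" "z \<in> X"
    \<comment> \<open>Since \<open>x\<close> and \<open>z\<close> lie on the same side of inversion,
      only the characters at \<open>x - z\<close> and \<open>z - x\<close> can be trivial; both
      enter with a minus sign, whence the -1 in \<open>?J\<close>.\<close>
    have nz: "x + z \<noteq> 0" "- x - z \<noteq> 0"
      using half_system_notin(3)[OF hs xz(1)] xz
      by (metis add_eq_0_iff, metis add_eq_0_iff2 add_uminus_conv_diff minus_add_distrib neg_equal_0_iff_equal minus_minus)
    have es: "(\<Sum>y\<in>UNIV. e y w) = of_nat CARD('g) * of_bool (w = 0)" for w
      using e_sum[of w] by (simp add: e_commute[of w])
    have "(\<Sum>y\<in>X. ?A x y * ?A y z) = (\<Sum>y\<in>UNIV. ?A x y * ?A y z) / 2"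
      using half[of "\<lambda>_. 1" x z] by simp
    also have "\<dots> = ?J x z"
      unfolding AA sum_divide_distrib[symmetric] sum.distrib sum_subtractf es sqrt_card
      using nz by auto
    finally show "(\<Sum>y\<in>X. ?A x y * ?A y z) = ?J x z" .
    have qd: "q (z - x) = q (x - z)" "q (- x - z) = q (x + z)"
      using q_minus[of "x - z"] q_minus[of "x + z"] by simp_all
    \<comment> \<open>Each of the four characters is a translated Gauss sum, and evenness of
      \<open>q\<close> merges them in pairs.\<close>
    have gt: "(\<Sum>y\<in>UNIV. q y * (e y (x + z) - e y (x - z) - e y (z - x) + e y (- x - z)))
        = 2 * ?r * gauss_sum q * (inverse (q (x + z)) - inverse (q (x - z)))"
      unfolding distrib_left right_diff_distrib sum.distrib sum_subtractf gauss_translate qd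
      by (simp add: algebra_simps)
    have "(\<Sum>y\<in>X. ?A x y * (q y * ?A y z)) = (\<Sum>y\<in>X. q y * (?A x y * ?A y z))"
      by (simp add: mult_ac)
    also have "\<dots> = (\<Sum>y\<in>UNIV. q y * (?A x y * ?A y z)) / 2" by (rule half) simp
    also have "\<dots> = (\<Sum>y\<in>UNIV. q y * (e y (x + z) - e y (x - z) - e y (z - x) + e y (- x - z))) / (2 * ?r * ?r)"
      unfolding AA by (simp add: sum_divide_distrib mult_ac)
    also have "\<dots> = gauss_sum q * (inverse (q (x + z)) - inverse (q (x - z))) / ?r"
      unfolding gt by (simp add: sqrt_card(2))
    also have "\<dots> = gauss_sum q * inverse (q x) * (- ?A x z * inverse (q z))"
      using q_add[of x z] q_add[of x "- z"]
      by (simp add: e_minus e_cnj divide_inverse algebra_simps)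
    also have "- ?A x z = (\<Sum>y\<in>{x}. ?J x y * ?A y z)"
      by (simp add: divide_inverse algebra_simps)
    also have "\<dots> = (\<Sum>y\<in>X. ?J x y * ?A y z)"
      by (rule sum.mono_neutral_left) (use xz in auto)
    finally show "(\<Sum>y\<in>X. ?A x y * (q y * ?A y z)) =
      gauss_sum q * inverse (q x) * ((\<Sum>y\<in>X. ?J x y * ?A y z) * inverse (q z))" .
  qed (simp_all add: dJ)
  then show ?thesis by (simp add: dJ)
qed

end

section \<open>Cyclic Sylow 2-subgroups\<close>

text \<open>Applied to negation and to translation by an element of order 2, this links the parity
  of a subgroup to the presence of an involution in it.\<close>

lemma even_card_fixpoint_free_involution:
  assumes "finite A" and "\<And>x. x \<in> A \<Longrightarrow> f x \<in> A" and "\<And>x. x \<in> A \<Longrightarrow> f (f x) = x"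
    and "\<And>x. x \<in> A \<Longrightarrow> f x \<noteq> x"
  shows "even (card A)"
  using assms
proof (induction A rule: finite_psubset_induct)
  case (psubset A)
  show ?case
  proof (cases "A = {}")
    case False
    then obtain x where x: "x \<in> A" by blast
    have fx: "f x \<in> A" "f x \<noteq> x" using psubset.prems x by auto
    have "even (card (A - {x, f x}))"
    proof (rule psubset.IH)
      fix y assume y: "y \<in> A - {x, f x}"
      then have "f (f y) = y" using psubset.prems by simp
      then have "f y \<noteq> x" "f y \<noteq> f x" using y psubset.prems(2)[of x] x by auto
      then show "f y \<in> A - {x, f x}" using y psubset.prems(1) by auto
    qed (use x psubset.prems in auto)
    moreover have "card A = card (A - {x, f x}) + 2"
      using x fx psubset.hyps card_Diff_subset[of "{x, f x}" A] card_mono[of A "{x, f x}"] by auto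
    ultimately show ?thesis by simp
  qed simp
qed

section \<open>Subgroups and multiplication by natural numbers\<close>

definition add_subgroup :: "'g :: ab_group_add set \<Rightarrow> bool" where
  "add_subgroup H \<longleftrightarrow> 0 \<in> H \<and> (\<forall>x\<in>H. \<forall>y\<in>H. x - y \<in> H)"

lemma add_subgroupD:
  assumes "add_subgroup H"
  shows "0 \<in> H" "\<And>x. x \<in> H \<Longrightarrow> - x \<in> H" "\<And>x y. x \<in> H \<Longrightarrow> y \<in> H \<Longrightarrow> x - y \<in> H"
    "\<And>x y. x \<in> H \<Longrightarrow> y \<in> H \<Longrightarrow> x + y \<in> H"
proof -
  show 0: "0 \<in> H" and d: "\<And>x y. x \<in> H \<Longrightarrow> y \<in> H \<Longrightarrow> x - y \<in> H"
    using assms by (auto simp: add_subgroup_def)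
  show m: "- x \<in> H" if "x \<in> H" for x using d[OF 0 that] by simp
  show "x + y \<in> H" if "x \<in> H" "y \<in> H" for x y using d[OF that(1) m[OF that(2)]] by simp
qed

primrec nat_mul :: "nat \<Rightarrow> 'g :: ab_group_add \<Rightarrow> 'g" where
  "nat_mul 0 x = 0"
| "nat_mul (Suc m) x = x + nat_mul m x"

lemma nat_mul_zero [simp]: "nat_mul m 0 = 0"
  by (induction m) auto

lemma nat_mul_add_left: "nat_mul (m + m') x = nat_mul m x + nat_mul m' x"
  by (induction m) (auto simp: add.assoc)

lemma nat_mul_mult: "nat_mul (m * m') x = nat_mul m (nat_mul m' x)"
  by (induction m) (auto simp: nat_mul_add_left)

lemma nat_mul_add: "nat_mul m (x + y) = nat_mul m x + nat_mul m y"
  by (induction m) (auto simp: algebra_simps)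

lemma nat_mul_minus: "nat_mul m (x - y) = nat_mul m x - nat_mul m y"
  using nat_mul_add[of m "x - y" y] by (simp add: algebra_simps)

lemma nat_mul_two: "nat_mul 2 x = x + x"
  by (simp add: numeral_2_eq_2)

lemma nat_mul_subgroup: "add_subgroup H \<Longrightarrow> x \<in> H \<Longrightarrow> nat_mul m x \<in> H"
  by (induction m) (auto simp: add_subgroupD)

lemma add_subgroup_nat_mul_image:
  fixes H :: "'g :: ab_group_add set"
  assumes "add_subgroup H"
  shows "add_subgroup (nat_mul m ` H)"
proof -
  have "0 \<in> nat_mul m ` H"
    using add_subgroupD(1)[OF assms] by (metis imageI nat_mul_zero)
  moreover have "nat_mul m x - nat_mul m y \<in> nat_mul m ` H" if "x \<in> H" "y \<in> H" for x y
    using add_subgroupD(3)[OF assms that] by (metis imageI nat_mul_minus)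
  ultimately show ?thesis unfolding add_subgroup_def by blast
qed

lemma add_subgroup_UNIV: "add_subgroup UNIV"
  by (simp add: add_subgroup_def)

text \<open>Doubling on \<open>H\<close> has kernel \<open>two_torsion\<close>, so its nonempty
  fibres are cosets of that kernel.\<close>

lemma card_double_image:
  fixes H :: "'g :: {finite, ab_group_add} set"
  assumes H: "add_subgroup H" and K: "two_torsion \<subseteq> H"
  shows "card H = card (two_torsion :: 'g set) * card (nat_mul 2 ` H)"
proof -
  have "card {x \<in> H. nat_mul 2 x = y} = card (two_torsion :: 'g set)" if "y \<in> nat_mul 2 ` H" for y
  proof -
    obtain x where x: "x \<in> H" "y = nat_mul 2 x" using \<open>y \<in> nat_mul 2 ` H\<close> by blast
    have "{z \<in> H. nat_mul 2 z = y} = (+) x ` two_torsion"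
    proof (intro set_eqI iffI)
      fix z assume "z \<in> {z \<in> H. nat_mul 2 z = y}"
      then have "z - x \<in> two_torsion"
        by (simp add: x nat_mul_two two_torsion_def algebra_simps)
      then show "z \<in> (+) x ` two_torsion" by (rule rev_image_eqI) simp
    next
      fix z assume "z \<in> (+) x ` two_torsion"
      then obtain k where k: "k \<in> two_torsion" "z = x + k" by blast
      then have "k + k = 0" by (simp add: two_torsion_def)
      then have "nat_mul 2 z = y"
        unfolding x k nat_mul_add by (simp add: nat_mul_two)
      moreover have "z \<in> H" using k K x add_subgroupD(4)[OF H] by blast
      ultimately show "z \<in> {z \<in> H. nat_mul 2 z = y}" by simp
    qed
    then show ?thesis by (simp add: card_image)
  qed
  then have "(\<Sum>y\<in>nat_mul 2 ` H. \<Sum>x\<in>{x \<in> H. nat_mul 2 x = y}. 1)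
      = (\<Sum>y\<in>nat_mul 2 ` H. card (two_torsion :: 'g set))"
    by (intro sum.cong) simp_all
  then show ?thesis
    using sum.image_gen[of H "\<lambda>_. 1 :: nat" "nat_mul 2"] by simp
qed

lemma power_two_odd_decomposition:
  fixes n :: nat
  assumes "n > 0"
  obtains r s where "n = 2 ^ r * s" "odd s"
proof -
  have "\<exists>r s. n = 2 ^ r * s \<and> odd s"
    using assms
  proof (induction n rule: less_induct)
    case (less n)
    show ?case
    proof (cases "even n")
      case True
      then obtain m where m: "n = 2 * m" by blast
      with less.prems have "0 < m" "m < n" by auto
      then obtain r s where "m = 2 ^ r * s" "odd s" using less.IH by blast
      then have "n = 2 ^ Suc r * s \<and> odd s" using m by simp
      then show ?thesis by blast
    next
      case False
      then have "n = 2 ^ 0 * n \<and> odd n" by simp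
      then show ?thesis by blast
    qed
  qed
  then show ?thesis using that by blast
qed

lemma sum_squares_lessThan: "0 < N \<Longrightarrow> 6 * (\<Sum>j<N. j ^ 2) = N * (N - 1) * (2 * N - 1)" for N :: nat
proof (induction N rule: nat_induct_non_zero)
  case (Suc N)
  then obtain M where "N = Suc M" by (cases N) auto
  with Suc show ?case by (simp add: algebra_simps power2_eq_square)
qed simp

context metric_group_loc
begin

lemma e_nat_mul: "e (nat_mul m x) y = e x y ^ m" "e x (nat_mul m y) = e x y ^ m"
  by (induction m) (simp_all add: e_add_left e_add_right)

text \<open>The translation argument of \<open>e_power_card\<close>, carried out inside
  \<open>H\<close>.\<close>

lemma e_subgroup_power:
  assumes H: "add_subgroup H" and "x \<in> H"
  shows "e x y ^ card H = 1"
proof -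
  have "(\<Prod>z\<in>H. e z y) = (\<Prod>z\<in>H. e (x + z) y)"
    by (rule prod.reindex_bij_witness[of _ "\<lambda>z. x + z" "\<lambda>z. z - x"])
      (use add_subgroupD[OF H] assms(2) in auto)
  also have "\<dots> = e x y ^ card H * (\<Prod>z\<in>H. e z y)"
    by (simp add: e_add_left prod.distrib)
  finally show ?thesis by simp
qed

end

section \<open>Groups with exactly one involution, that is, with a nontrivial cyclic Sylow
  2-subgroup\<close>

locale single_involution = metric_group_loc q
  for q :: "'g :: {finite, ab_group_add} \<Rightarrow> complex" +
  fixes k :: 'g
  assumes torsion: "two_torsion = {0, k}" and k_nonzero: "k \<noteq> 0"
begin

lemma k_double: "k + k = 0"
proof -
  have "k \<in> two_torsion" unfolding torsion by simp
  then show ?thesis unfolding two_torsion_def by (rule CollectD)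
qed

text \<open>Without \<open>k\<close>, negation would have no fixed point on the nonzero elements of
  \<open>H\<close>, and the order of \<open>H\<close> would be odd.\<close>

lemma even_subgroup_mem:
  assumes H: "add_subgroup H" and "even (card H)"
  shows "k \<in> H"
proof (rule ccontr)
  assume k: "k \<notin> H"
  have "even (card (H - {0}))"
  proof (rule even_card_fixpoint_free_involution[where f = uminus])
    fix x assume x: "x \<in> H - {0}"
    then show "- x \<in> H - {0}" using add_subgroupD(2)[OF H] by simp
    show "- x \<noteq> x"
    proof
      assume "- x = x"
      then have "x \<in> two_torsion" by (metis (mono_tags) two_torsion_def mem_Collect_eq add.left_inverse)
      then show False using x k torsion by blast
    qed
  qed simp_all
  moreover have "card H = Suc (card (H - {0}))"
    using add_subgroupD(1)[OF H] by (intro card.remove) simp_all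
  ultimately show False using assms(2) by simp
qed

lemma odd_subgroup_notin:
  assumes H: "add_subgroup H" and "odd (card H)"
  shows "k \<notin> H"
proof
  assume k: "k \<in> H"
  have "even (card H)"
  proof (rule even_card_fixpoint_free_involution[where f = "\<lambda>x. x + k"])
    show "x + k \<in> H" if "x \<in> H" for x using add_subgroupD(4)[OF H that k] .
    show "x + k + k = x" for x by (simp add: add.assoc k_double)
  qed (simp_all add: k_nonzero)
  then show False using assms(2) by simp
qed

lemma card_torsion: "card (two_torsion :: 'g set) = 2"
  unfolding torsion using k_nonzero by simp

text \<open>As long as the image has even order it contains \<open>k\<close>, hence the whole
  2-torsion, and the next doubling halves it.\<close>

lemma card_power_two_image:
  assumes "CARD('g) = 2 ^ r * s" "j \<le> r"
  shows "card (range (nat_mul (2 ^ j) :: 'g \<Rightarrow> 'g)) = 2 ^ (r - j) * s"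
  using assms(2)
proof (induction j)
  case 0
  have "range (nat_mul (Suc 0) :: 'g \<Rightarrow> 'g) = UNIV" by simp
  then show ?case using assms(1) by simp
next
  case (Suc j)
  let ?H = "range (nat_mul (2 ^ j) :: 'g \<Rightarrow> 'g)"
  have H: "add_subgroup ?H" by (intro add_subgroup_nat_mul_image add_subgroup_UNIV)
  have c: "card ?H = 2 * (2 ^ (r - Suc j) * s)"
    using Suc by (simp add: Suc_diff_le flip: power_Suc Suc_diff_le)
  then have "k \<in> ?H" by (intro even_subgroup_mem H) simp
  then have "card ?H = 2 * card (nat_mul 2 ` ?H)"
    using card_double_image[OF H] add_subgroupD(1)[OF H] \<open>k \<in> ?H\<close> unfolding card_torsion by (simp add: torsion[THEN equalityD1, THEN order_trans])
  moreover have "nat_mul 2 ` ?H = range (nat_mul (2 ^ Suc j))"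
    by (auto simp: nat_mul_mult image_image)
  ultimately show ?case using c by simp
qed

text \<open>The group is the direct sum of a cyclic group of order \<open>2 ^ Suc r\<close>,
  generated by some \<open>y\<close>, and the subgroup \<open>?O\<close> of odd order
  \<open>s\<close>. Raising to the power 6 \<open>s\<close> kills the contribution of
  \<open>?O\<close>, so the product becomes a power of \<open>e y y\<close> whose exponent is a sum
  of squares.\<close>

lemma prod_q_power:
  assumes rs: "CARD('g) = 2 ^ Suc r * s" "odd s"
  shows "((\<Prod>x\<in>UNIV. q x) ^ 6) ^ s = - 1"
proof -
  let ?N = "2 ^ Suc r :: nat" and ?O = "range (nat_mul (2 ^ Suc r) :: 'g \<Rightarrow> 'g)"
  have O: "add_subgroup ?O" by (intro add_subgroup_nat_mul_image add_subgroup_UNIV)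
  have cO: "card ?O = s" using card_power_two_image[OF rs(1), of "Suc r"] by simp
  have kO: "k \<notin> ?O" using odd_subgroup_notin[OF O] cO rs(2) by simp
  let ?H = "range (nat_mul (2 ^ r) :: 'g \<Rightarrow> 'g)"
  have "k \<in> ?H"
    using card_power_two_image[OF rs(1), of r]
    by (intro even_subgroup_mem add_subgroup_nat_mul_image add_subgroup_UNIV) (simp add: Suc_diff_le)
  \<comment> \<open>As \<open>k\<close> has order 2, \<open>y\<close> has order
    \<open>2 ^ Suc r\<close>: it generates the Sylow 2-subgroup.\<close>
  then obtain y where y: "k = nat_mul (2 ^ r) y" by blast
  let ?f = "\<lambda>(j, x). nat_mul j y + x :: 'g"
  have odd_mul: "nat_mul b k = k" if "odd b" for b
  proof -
    obtain b' where "b = Suc (b' * 2)" using \<open>odd b\<close> by (metis oddE Suc_eq_plus1 mult.commute)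
    then show ?thesis by (simp add: nat_mul_mult nat_mul_two k_double)
  qed
  \<comment> \<open>If \<open>i\<close> has 2-part \<open>2 ^ a\<close>, then
    \<open>2 ^ (r - a)\<close> times \<open>nat_mul i y\<close> is an odd multiple of
    \<open>k\<close>, hence \<open>k\<close> itself, which is not in \<open>?O\<close>. So the
    multiples of \<open>y\<close> below \<open>?N\<close> lie in different cosets of
    \<open>?O\<close>.\<close>
  have key: False if i: "nat_mul i y \<in> ?O" "0 < i" "i < ?N" for i
  proof -
    obtain a b where ab: "i = 2 ^ a * b" "odd b" using power_two_odd_decomposition[OF i(2)] .
    have "2 ^ a \<le> i" using ab i(2) by (cases b) auto
    then have "(2 :: nat) ^ a < 2 ^ Suc r" using i(3) by linarith
    then have "a \<le> r" by (simp add: power_strict_increasing_iff del: power_Suc)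
    then have "2 ^ (r - a) * i = b * 2 ^ r" unfolding ab(1) by (simp flip: power_add)
    then have "nat_mul (2 ^ (r - a)) (nat_mul i y) = k"
      by (simp add: nat_mul_mult[symmetric]) (simp add: nat_mul_mult y[symmetric] odd_mul ab(2))
    then show False using nat_mul_subgroup[OF O i(1)] kO by metis
  qed
  have le: "\<not> j < j'" if eq: "nat_mul j y + x = nat_mul j' y + x'"
    and mem: "x \<in> ?O" "x' \<in> ?O" and "j' < ?N" for j j' x x'
  proof
    assume "j < j'"
    then have "nat_mul j' y = nat_mul j y + nat_mul (j' - j) y"
      by (simp flip: nat_mul_add_left)
    then have "nat_mul (j' - j) y = x - x'" using eq by (simp add: algebra_simps)
    then have "nat_mul (j' - j) y \<in> ?O" using add_subgroupD(3)[OF O mem] by simp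
    moreover have "0 < j' - j" "j' - j < ?N" using \<open>j < j'\<close> \<open>j' < ?N\<close> by linarith+
    ultimately show False by (rule key)
  qed
  have inj: "inj_on ?f ({..<?N} \<times> ?O)"
  proof (rule inj_onI)
    fix p p' assume p: "p \<in> {..<?N} \<times> ?O" "p' \<in> {..<?N} \<times> ?O" "?f p = ?f p'"
    obtain j x j' x' where [simp]: "p = (j, x)" "p' = (j', x')" by (metis surj_pair)
    have "\<not> j < j'" "\<not> j' < j"
      using le[of j x j' x'] le[of j' x' j x] p by auto
    then show "p = p'" using p(3) by simp
  qed
  \<comment> \<open>An injective image of \<open>?N\<close> times \<open>s\<close> elements fills
    the group.\<close>
  have surj: "?f ` ({..<?N} \<times> ?O) = UNIV"
    by (rule card_subset_eq) (simp, simp, simp only: card_image[OF inj] card_cartesian_product cO rs card_lessThan)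
  have decomp: "\<exists>j w. x = nat_mul j y + nat_mul ?N w" for x
  proof -
    have "x \<in> ?f ` ({..<?N} \<times> ?O)" by (simp only: surj UNIV_I)
    then show ?thesis by auto
  qed
  have k2: "k \<in> two_torsion" unfolding torsion by simp
  \<comment> \<open>Since \<open>e k w\<close> is a sign and \<open>?N\<close> is even,
    \<open>k\<close> pairs trivially with \<open>?O\<close>. If it also paired trivially with
    \<open>y\<close>, nondegeneracy would fail.\<close>
  have eky: "e k y = - 1"
  proof (rule ccontr)
    assume "e k y \<noteq> - 1"
    then have 1: "e k y = 1" using e_torsion_cases[OF k2, of y] by blast
    have "e k x = 1" for x
    proof -
      obtain j w where "x = nat_mul j y + nat_mul ?N w" using decomp by blast
      moreover have "e k w ^ ?N = 1" using e_torsion_square[OF k2, of w] by (simp add: power_mult)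
      ultimately show ?thesis by (simp add: e_add_right e_nat_mul 1)
    qed
    then show False using e_nondegenerate k_nonzero by blast
  qed
  \<comment> \<open>The even exponent replaces \<open>q\<close> by the bicharacter through
    \<open>e_self\<close>; every factor that involves \<open>x\<close> is an \<open>s\<close>-th
    root of unity.\<close>
  have term_power: "q (nat_mul j y + x) ^ (6 * s) = e y y ^ (3 * s * j ^ 2)" if "x \<in> ?O" for j x
  proof -
    have x1: "e x z ^ s = 1" for z using e_subgroup_power[OF O that, of z] cO by simp
    have "q (nat_mul j y + x) ^ (6 * s) = (e (nat_mul j y + x) (nat_mul j y + x)) ^ (3 * s)"
      by (simp add: e_self power_mult[symmetric])
    also have "\<dots> = (e y y ^ (j * j) * (e x y ^ (2 * j) * e x x)) ^ (3 * s)"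
      by (simp add: e_add_left e_add_right e_nat_mul e_commute[of y x] power_mult power_mult_distrib
          power2_eq_square mult_ac)
    also have "\<dots> = e y y ^ (j * j * (3 * s)) * ((e x y ^ s) ^ (2 * j * 3) * (e x x ^ s) ^ 3)"
      by (simp only: power_mult_distrib power_mult[symmetric]) (simp add: mult_ac)
    finally show ?thesis by (simp add: x1 power2_eq_square mult_ac)
  qed
  have "((\<Prod>x\<in>UNIV. q x) ^ 6) ^ s = (\<Prod>x\<in>UNIV. q x ^ (6 * s))"
    by (simp add: power_mult[symmetric] prod_power_distrib)
  also have "\<dots> = (\<Prod>(j, x)\<in>{..<?N} \<times> ?O. q (nat_mul j y + x) ^ (6 * s))"
    using prod.reindex_bij_betw[OF bij_betw_imageI[OF inj surj], of "\<lambda>x. q x ^ (6 * s)"]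
    by (simp add: case_prod_unfold)
  also have "\<dots> = (\<Prod>j<?N. \<Prod>x\<in>?O. e y y ^ (3 * s * j ^ 2))"
    unfolding prod.cartesian_product[symmetric] by (intro prod.cong refl term_power)
  also have "\<dots> = e y y ^ (\<Sum>j<?N. 3 * s * j ^ 2 * s)"
    by (simp only: prod_constant cO) (simp add: power_sum power_mult)
  \<comment> \<open>The factor 3 and the factor 2 of \<open>?N\<close> cancel the 6 in the sum of
    squares. The remaining \<open>2 ^ r\<close> turns \<open>e y y\<close> into
    \<open>e k y\<close>, raised to an odd power.\<close>
  also have "(\<Sum>j<?N. 3 * s * j ^ 2 * s) = 2 ^ r * ((?N - 1) * (2 * ?N - 1) * s * s)"
  proof -
    have "2 * (\<Sum>j<?N. 3 * s * j ^ 2 * s) = (6 * (\<Sum>j<?N. j ^ 2)) * (s * s)"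
      by (simp add: sum_distrib_left sum_distrib_right mult_ac)
    also have "\<dots> = 2 * (2 ^ r * ((?N - 1) * (2 * ?N - 1) * s * s))"
      by (subst sum_squares_lessThan) (simp_all add: mult_ac)
    finally show ?thesis by simp
  qed
  also have "e y y ^ \<dots> = (e k y) ^ ((?N - 1) * (2 * ?N - 1) * s * s)"
    unfolding y e_nat_mul by (simp add: power_mult)
  also have "\<dots> = - 1"
    unfolding eky using rs(2) by simp
  finally show ?thesis .
qed

text \<open>Let U be the sixth power of the product of all \<open>q x\<close>. If the squared Gauss
  sum is 1, then U = (-1)^\<open>card X\<close> by the full relation, while U^\<open>s\<close> = -1
  for the odd part \<open>s\<close> of the order; so \<open>card X\<close> is odd and U = -1. Then 4
  divides the group order, \<open>k\<close> is a double and \<open>q k\<close> squares to 1.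
  Splitting the product along the half system and using the odd relation now gives U = 1, a
  contradiction.\<close>

lemma gauss_sum_square_not_one:
  fixes X :: "'g set"
  assumes hs: "half_system two_torsion X"
  shows "gauss_sum q ^ 2 \<noteq> 1"
proof
  assume c: "gauss_sum q ^ 2 = 1"
  have n: "CARD('g) = 2 + 2 * card X"
    using half_system_card[OF hs] card_torsion by simp
  obtain r' s where rs': "CARD('g) = 2 ^ r' * s" "odd s"
    using power_two_odd_decomposition[of "CARD('g)"] by auto
  then obtain r where r: "r' = Suc r" using n by (cases r') auto
  define U where "U = (\<Prod>x\<in>UNIV. q x) ^ 6"
  have "U = (- 1) ^ card X"
    unfolding U_def gauss_sum_power_full[OF hs] by (simp add: power_mult c)
  moreover have "U ^ s = - 1"
    unfolding U_def using prod_q_power[of r s] rs' r by simp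
  ultimately have X: "odd (card X)" and U: "U = - 1"
    by (cases "even (card X)"; simp)+
  have "CARD('g) = 2 * card (range (nat_mul 2 :: 'g \<Rightarrow> 'g))"
    using card_double_image[where H = "UNIV :: 'g set", OF add_subgroup_UNIV] card_torsion by simp
  then have "card (range (nat_mul 2 :: 'g \<Rightarrow> 'g)) = Suc (card X)" using n by linarith
  then have "even (card (range (nat_mul 2 :: 'g \<Rightarrow> 'g)))" using X by simp
  then have "k \<in> range (nat_mul 2)"
    by (intro even_subgroup_mem add_subgroup_nat_mul_image add_subgroup_UNIV)
  then obtain z where z: "k = nat_mul 2 z" by blast
  have k2: "k \<in> two_torsion" unfolding torsion by simp
  have "e k k = e k z ^ 2" by (subst (2) z) (simp add: e_nat_mul)
  then have kk: "(q k)\<^sup>2 = 1" using e_torsion_square[OF k2] by (simp add: e_self)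
  have "(\<Prod>x\<in>UNIV. q x) = (\<Prod>x\<in>{0, k}. q x) * (\<Prod>x\<in>X. q x)\<^sup>2"
    using half_system_prod[OF hs, of q] unfolding torsion by simp
  also have "(\<Prod>x\<in>{0, k}. q x) = q k" using k_nonzero by simp
  finally have "U = ((q k)\<^sup>2) ^ 3 * ((\<Prod>x\<in>X. q x) ^ 6)\<^sup>2"
    unfolding U_def by (simp add: power_mult_distrib power_mult[symmetric])
  also have "(\<Prod>x\<in>X. q x) ^ 6 = (- 1) ^ card X"
    unfolding gauss_sum_power_odd[OF hs] by (simp add: power_mult c)
  finally have "U = 1" using kk X by simp
  then show False using U by simp
qed

end

section \<open>The Verlinde form\<close>

definition sign_count :: "'g :: ab_group_add \<Rightarrow> 'g \<Rightarrow> 'g \<Rightarrow> complex" where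
  "sign_count g h l = of_bool (g + h + l = 0) + of_bool (g + h - l = 0) +
     of_bool (g - h + l = 0) + of_bool (g - h - l = 0)"

section \<open>Roots of unity and sums of triple products of characters\<close>

context metric_group_loc
begin

text \<open>The relation of \<open>gauss_sum_power_full\<close> is raised to the power
  \<open>CARD('g)\<close>: the squares \<open>e x x\<close> of the values of \<open>q\<close> are
  roots of unity of that order, and the parity assumption removes the sign.\<close>

lemma gauss_sum_power_card_square:
  fixes X :: "'g set"
  assumes hs: "half_system two_torsion X" and ev: "even (card X * CARD('g))"
  shows "(gauss_sum q)\<^sup>2 ^ CARD('g)\<^sup>2 = 1"
proof -
  have "((\<Prod>x\<in>UNIV. q x) ^ 6) ^ CARD('g) = (\<Prod>x\<in>UNIV. (e x x ^ CARD('g)) ^ 3)"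
    by (simp add: e_self prod_power_distrib power_mult[symmetric] mult.commute)
  also have "\<dots> = 1" by (simp add: e_power_card)
  finally have "(gauss_sum q ^ (2 * CARD('g)) * (- 1) ^ card X) ^ CARD('g) = 1"
    unfolding gauss_sum_power_full[OF hs] .
  then have "gauss_sum q ^ (2 * CARD('g) * CARD('g)) * (- 1) ^ (card X * CARD('g)) = 1"
    by (simp add: power_mult_distrib power_mult)
  moreover have "(- 1 :: complex) ^ (card X * CARD('g)) = 1"
    using ev by (simp only: minus_one_power_iff if_True)
  ultimately have "gauss_sum q ^ (2 * CARD('g) * CARD('g)) = 1" by (simp only: mult_1_right)
  then show ?thesis by (simp only: power_mult[symmetric] power2_eq_square[of "CARD('g)"] mult.assoc)
qed

definition triple_real_product :: "'g \<Rightarrow> 'g \<Rightarrow> 'g \<Rightarrow> 'g \<Rightarrow> complex" where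
  "triple_real_product g h l x = (e g x + cnj (e g x)) * (e h x + cnj (e h x)) * (e l x + cnj (e l x))"

text \<open>The product expands into eight characters, two for each sign pattern counted by
  \<open>sign_count\<close>, and orthogonality keeps the trivial ones.\<close>

lemma sum_triple_real_product:
  "(\<Sum>x\<in>UNIV. triple_real_product g h l x) = 2 * of_nat CARD('g) * sign_count g h l"
proof -
  have s: "e (u + v) x = e u x * e v x" "e (u - v) x = e u x * cnj (e v x)" "e (- u) x = cnj (e u x)" for u v x
    using e_add_left[of u "- v" x] by (simp_all add: e_add_left e_minus)
  have "triple_real_product g h l x =
      e (g + h + l) x + e (g + h - l) x + e (g - h + l) x + e (g - h - l) x +
      (e (- (g + h + l)) x + e (- (g + h - l)) x + e (- (g - h + l)) x + e (- (g - h - l)) x)" for x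
    unfolding triple_real_product_def s complex_cnj_mult complex_cnj_cnj by (simp add: algebra_simps)
  then show ?thesis
    unfolding sign_count_def by (simp only: sum.distrib e_sum neg_equal_0_iff_equal) (simp add: algebra_simps)
qed

text \<open>On \<open>A\<close> the characters are real, so each triple product is 8 times a product
  of characters. The cases used are \<open>A\<close> = \<open>two_torsion\<close> for the even group
  and \<open>A\<close> = {0} for the odd one.\<close>

lemma half_sum_triple_real_product:
  assumes "half_system A X" and A: "A \<subseteq> two_torsion"
  shows "(\<Sum>x\<in>X. triple_real_product g h l x) =
    of_nat CARD('g) * sign_count g h l - 4 * (\<Sum>x\<in>A. e g x * e h x * e l x)"
proof -
  have "triple_real_product g h l (- x) = triple_real_product g h l x" for x
    by (simp add: triple_real_product_def e_minus add.commute)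
  from half_system_sum[OF assms(1), of "triple_real_product g h l", OF this]
  have "2 * of_nat CARD('g) * sign_count g h l =
      (\<Sum>x\<in>A. triple_real_product g h l x) + 2 * (\<Sum>x\<in>X. triple_real_product g h l x)"
    unfolding sum_triple_real_product by simp
  also have "(\<Sum>x\<in>A. triple_real_product g h l x) = (\<Sum>x\<in>A. 8 * (e g x * e h x * e l x))"
  proof (rule sum.cong)
    fix x assume "x \<in> A"
    then have "cnj (e u x) = e u x" for u using A e_torsion_cnj[of x u] e_commute by auto
    then show "triple_real_product g h l x = 8 * (e g x * e h x * e l x)"
      by (simp add: triple_real_product_def)
  qed simp
  also have "\<dots> = 8 * (\<Sum>x\<in>A. e g x * e h x * e l x)" by (simp add: sum_distrib_left)
  finally have "2 * (\<Sum>x\<in>X. triple_real_product g h l x) =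
      2 * (of_nat CARD('g) * sign_count g h l - 4 * (\<Sum>x\<in>A. e g x * e h x * e l x))"
    by (simp add: algebra_simps)
  then show ?thesis by (simp only: mult_cancel_left) simp
qed

end

section \<open>The columns of \<open>S\<close> and the trilinear form on them\<close>

definition comb :: "complex \<Rightarrow> ('i \<Rightarrow> complex) \<Rightarrow> complex \<Rightarrow> ('i \<Rightarrow> complex) \<Rightarrow> 'i \<Rightarrow> complex" where
  "comb \<alpha> u \<beta> v = (\<lambda>i. \<alpha> * u i + \<beta> * v i)"

locale metric_group_pair =
  G: metric_group_loc q1 + H: metric_group_loc q2
  for q1 :: "'g :: {finite, ab_group_add} \<Rightarrow> complex"
    and q2 :: "'h :: {finite, ab_group_add} \<Rightarrow> complex" +
  fixes c :: complex and Gs :: "'g set" and Hs :: "'h set" and a b :: complex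
  assumes card_parity: "even CARD('g)" "odd CARD('h)"
    and half_systems: "half_system two_torsion Gs" "half_system {0} Hs"
    and a_def: "a = 1 / complex_of_real (sqrt (real CARD('g)))"
    and b_def: "b = 1 / complex_of_real (sqrt (real CARD('h)))"
begin

abbreviation J :: "('g, 'h) index set" where "J \<equiv> index_set Gs Hs"
abbreviation S :: "('g, 'h) index \<Rightarrow> ('g, 'h) index \<Rightarrow> complex" where "S \<equiv> S_matrix c q1 q2"

definition ratio :: complex where
  "ratio = 4 / (of_nat CARD('h) - of_nat CARD('g))"

lemma a_square: "a * a * of_nat CARD('g) = 1" and b_square: "b * b * of_nat CARD('h) = 1"
  using G.sqrt_card H.sqrt_card by (simp_all add: a_def b_def)

text \<open>The parities make the two group orders different, so a and b differ and no entry of row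
  0 vanishes.\<close>

lemma ab_nonzero: "a \<noteq> 0" "b \<noteq> 0" "a - b \<noteq> 0" "a + b \<noteq> 0" "a * a - b * b \<noteq> 0"
proof -
  show 0: "a \<noteq> 0" "b \<noteq> 0" using a_square b_square by auto
  show d: "a * a - b * b \<noteq> 0"
  proof
    assume "a * a - b * b = 0"
    then have "a * a * of_nat CARD('h) = a * a * of_nat CARD('g)" using a_square b_square by simp
    then have "CARD('h) = CARD('g)" using 0 by simp
    then show False using card_parity by simp
  qed
  then show "a - b \<noteq> 0" "a + b \<noteq> 0" by (auto simp: add_eq_0_iff)
qed

lemma ratio_eq: "ratio = 4 * (a * a) * (b * b) / (a * a - b * b)"
proof -
  have n: "of_nat CARD('g) = 1 / (a * a)" "of_nat CARD('h) = 1 / (b * b)"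
    using a_square b_square ab_nonzero(1,2) by (simp_all add: field_simps)
  have "1 / (b * b) - 1 / (a * a) = (a * a - b * b) / ((a * a) * (b * b))"
    using ab_nonzero(1,2) by (simp add: diff_frac_eq mult_ac)
  then show ?thesis
    unfolding ratio_def n by simp
qed

definition X :: "'g \<Rightarrow> ('g, 'h) index \<Rightarrow> complex" where
  "X g i = (case i of Ix_K k \<epsilon> \<Rightarrow> a * bichar q1 g k
     | Ix_G h \<Rightarrow> a * (bichar q1 g h + cnj (bichar q1 g h)) | Ix_\<Gamma> \<gamma> \<Rightarrow> 0 | _ \<Rightarrow> a)"

definition Y :: "'h \<Rightarrow> ('g, 'h) index \<Rightarrow> complex" where
  "Y g i = (case i of Ix_0 \<Rightarrow> b | Ix_pi \<Rightarrow> - b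
     | Ix_\<Gamma> h \<Rightarrow> - b * (bichar q2 g h + cnj (bichar q2 g h)) | _ \<Rightarrow> 0)"

definition D :: "'g \<Rightarrow> ('g, 'h) index \<Rightarrow> complex" where
  "D k i = (case i of Ix_K h \<epsilon> \<Rightarrow> c * of_int \<epsilon> * q1 k * of_bool (k = h) | _ \<Rightarrow> 0)"

definition column :: "('g, 'h) index \<Rightarrow> ('g, 'h) index \<Rightarrow> complex" where
  "column i = (case i of Ix_0 \<Rightarrow> comb (1/2) (X 0) (-1/2) (Y 0) | Ix_pi \<Rightarrow> comb (1/2) (X 0) (1/2) (Y 0)
     | Ix_K k \<epsilon> \<Rightarrow> comb (1/2) (X k) (of_int \<epsilon> / 2) (D k) | Ix_G g \<Rightarrow> X g | Ix_\<Gamma> \<gamma> \<Rightarrow> Y \<gamma>)"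

lemmas S_simps = S_matrix_def[of c q1 q2, unfolded Let_def, folded a_def b_def]

lemma S_column:
  assumes "j \<in> J"
  shows "S i j = column j i"
proof (cases j)
  case (Ix_K k \<epsilon>)
  then have "k \<in> two_torsion" using assms by (auto simp: index_set_def)
  then have r: "cnj (bichar q1 k h) = bichar q1 k h" for h using G.e_torsion_cnj by blast
  note defs = S_simps column_def X_def Y_def D_def comb_def
  show ?thesis
  proof (cases i)
    case (Ix_K k' \<epsilon>')
    then show ?thesis using \<open>j = Ix_K k \<epsilon>\<close> G.e_commute[of k' k]
      by (cases "k = k'") (simp_all add: defs add_divide_distrib)
  next
    case (Ix_G g)
    then show ?thesis using \<open>j = Ix_K k \<epsilon>\<close> G.e_commute[of g k] r by (simp add: defs)
  qed (simp_all add: \<open>j = Ix_K k \<epsilon>\<close> defs)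
next
  case (Ix_G g)
  then show ?thesis
    by (cases i) (simp_all add: S_simps column_def X_def G.e_commute[of g])
next
  case (Ix_\<Gamma> \<gamma>)
  then show ?thesis
    by (cases i) (simp_all add: S_simps column_def Y_def H.e_commute[of \<gamma>])
qed (cases i; simp add: S_simps column_def X_def Y_def comb_def diff_divide_distrib add_divide_distrib)+

definition form ::
  "(('g, 'h) index \<Rightarrow> complex) \<Rightarrow> (('g, 'h) index \<Rightarrow> complex) \<Rightarrow> (('g, 'h) index \<Rightarrow> complex) \<Rightarrow> complex" where
  "form u v w = (\<Sum>i\<in>J. u i * v i * w i / S Ix_0 i)"

lemma N_coeff_form:
  assumes "i \<in> J" "j \<in> J" "k \<in> J"
  shows "N_coeff J S Ix_0 i j k = form (column i) (column j) (column k)"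
  unfolding N_coeff_def form_def by (simp add: S_column[OF assms(1)] S_column[OF assms(2)] S_column[OF assms(3)])

lemma form_swap: "form u v w = form v u w" "form u v w = form u w v"
  by (simp_all add: form_def mult_ac)

lemma form_comb:
  "form (comb \<alpha> u \<beta> v) x y = \<alpha> * form u x y + \<beta> * form v x y"
  "form x (comb \<alpha> u \<beta> v) y = \<alpha> * form x u y + \<beta> * form x v y"
  "form x y (comb \<alpha> u \<beta> v) = \<alpha> * form x y u + \<beta> * form x y v"
  by (simp_all add: form_def comb_def sum_distrib_left sum.distrib[symmetric] add_divide_distrib algebra_simps)

lemma S_row_0:
  "S Ix_0 Ix_0 = (a - b) / 2" "S Ix_0 Ix_pi = (a + b) / 2" "S Ix_0 (Ix_K k \<epsilon>) = a / 2"
  "S Ix_0 (Ix_G g) = a" "S Ix_0 (Ix_\<Gamma> \<gamma>) = b"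
  by (simp_all add: S_simps)

lemma sum_index_set:
  fixes f :: "('g, 'h) index \<Rightarrow> complex"
  shows "(\<Sum>i\<in>J. f i) = f Ix_0 + f Ix_pi + (\<Sum>k\<in>two_torsion - {0}. f (Ix_K k 1) + f (Ix_K k (- 1))) +
    (\<Sum>g\<in>Gs. f (Ix_G g)) + (\<Sum>\<gamma>\<in>Hs. f (Ix_\<Gamma> \<gamma>))"
proof -
  let ?K = "two_torsion - {0 :: 'g}"
  have J: "J = {Ix_0, Ix_pi} \<union> ((\<lambda>k. Ix_K k 1) ` ?K \<union> (\<lambda>k. Ix_K k (- 1)) ` ?K) \<union> Ix_G ` Gs \<union> Ix_\<Gamma> ` Hs"
    unfolding index_set_def by blast
  have "sum f J = sum f {Ix_0, Ix_pi} + (sum f ((\<lambda>k. Ix_K k 1) ` ?K) + sum f ((\<lambda>k. Ix_K k (- 1)) ` ?K)) +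
      sum f (Ix_G ` Gs) + sum f (Ix_\<Gamma> ` Hs)"
    unfolding J by (subst sum.union_disjoint, simp, simp, force)+ simp
  then show ?thesis by (simp add: sum.reindex inj_on_def sum.distrib)
qed

lemma form_expand: "form u v w =
    2 * (u Ix_0 * v Ix_0 * w Ix_0) / (a - b) + 2 * (u Ix_pi * v Ix_pi * w Ix_pi) / (a + b) +
    2 / a * (\<Sum>k\<in>two_torsion - {0}. u (Ix_K k 1) * v (Ix_K k 1) * w (Ix_K k 1) +
      u (Ix_K k (- 1)) * v (Ix_K k (- 1)) * w (Ix_K k (- 1))) +
    1 / a * (\<Sum>g\<in>Gs. u (Ix_G g) * v (Ix_G g) * w (Ix_G g)) +
    1 / b * (\<Sum>\<gamma>\<in>Hs. u (Ix_\<Gamma> \<gamma>) * v (Ix_\<Gamma> \<gamma>) * w (Ix_\<Gamma> \<gamma>))"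
  unfolding form_def sum_index_set S_row_0
  by (simp add: sum_distrib_left distrib_left sum.distrib mult_ac)

text \<open>The sum over the 2-torsion from the rows \<open>Ix_K\<close> cancels against the
  correction in the half sum over \<open>Gs\<close>, except for the term at 0. What remains, -4 a^2,
  combines with the rows \<open>Ix_0\<close> and \<open>Ix_pi\<close> to
  \<open>ratio\<close>.\<close>

lemma form_XXX: "form (X g) (X h) (X l) = ratio + sign_count g h l"
proof -
  let ?s = "\<Sum>k\<in>two_torsion. bichar q1 g k * bichar q1 h k * bichar q1 l k"
  have s: "(\<Sum>k\<in>two_torsion - {0}. bichar q1 g k * bichar q1 h k * bichar q1 l k) = ?s - 1"
    by (simp add: sum_diff1 two_torsion_def)
  have "form (X g) (X h) (X l) = 2 * (a * a * a) / (a - b) + 2 * (a * a * a) / (a + b) +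
      2 / a * (2 * a * a * a * (?s - 1)) + 1 / a * (a * a * a * (\<Sum>x\<in>Gs. G.triple_real_product g h l x))"
    unfolding form_expand s[symmetric] X_def G.triple_real_product_def sum_distrib_left
    by (simp add: mult_ac)
  also have "\<dots> = 2 * (a * a * a) / (a - b) + 2 * (a * a * a) / (a + b) - 4 * (a * a) +
      a * a * of_nat CARD('g) * sign_count g h l"
    unfolding G.half_sum_triple_real_product[OF half_systems(1) order_refl]
    using ab_nonzero(1) by (simp add: field_simps)
  also have "2 * (a * a * a) / (a - b) + 2 * (a * a * a) / (a + b) - 4 * (a * a) = ratio"
    unfolding ratio_eq using ab_nonzero by (simp add: field_simps)
  finally show ?thesis by (simp add: a_square)
qed

text \<open>Only the rows \<open>Ix_0\<close> and \<open>Ix_pi\<close> contribute, because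
  \<open>X\<close> and \<open>Y\<close> have no other row in common.\<close>

lemma form_XXY: "form (X g) (X h) (Y l) = ratio"
  unfolding form_expand ratio_eq X_def Y_def using ab_nonzero by (simp add: field_simps)

lemma form_XYY: "form (X g) (Y h) (Y l) = ratio"
  unfolding form_expand ratio_eq X_def Y_def using ab_nonzero by (simp add: field_simps)

lemma form_YYY: "form (Y g) (Y h) (Y l) = ratio - sign_count g h l"
proof -
  have "form (Y g) (Y h) (Y l) = 2 * (b * b * b) / (a - b) - 2 * (b * b * b) / (a + b) -
      1 / b * (b * b * b * (\<Sum>x\<in>Hs. H.triple_real_product g h l x))"
    unfolding form_expand Y_def H.triple_real_product_def sum_distrib_left
    by (simp add: mult_ac sum_negf)
  also have "\<dots> = 2 * (b * b * b) / (a - b) - 2 * (b * b * b) / (a + b) + 4 * (b * b) -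
      b * b * of_nat CARD('h) * sign_count g h l"
  proof -
    have "{0 :: 'h} \<subseteq> two_torsion" by (simp add: two_torsion_def)
    from H.half_sum_triple_real_product[OF half_systems(2) this, of g h l]
    have T: "(\<Sum>x\<in>Hs. H.triple_real_product g h l x) = of_nat CARD('h) * sign_count g h l - 4"
      by simp
    show ?thesis unfolding T using ab_nonzero(2) by (simp add: algebra_simps)
  qed
  also have "2 * (b * b * b) / (a - b) - 2 * (b * b * b) / (a + b) + 4 * (b * b) = ratio"
    unfolding ratio_eq using ab_nonzero by (simp add: field_simps)
  finally show ?thesis by (simp add: b_square)
qed

text \<open>\<open>D\<close> lives on the rows \<open>Ix_K\<close> and is odd in the sign, so an odd
  number of factors \<open>D\<close> cancels between the two signs; \<open>Y\<close> vanishes on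
  those rows.\<close>

lemma form_D_single:
  "form (X g) (X h) (D k) = 0" "form (X g) (Y l) (D k) = 0" "form (Y l) (Y m) (D k) = 0"
  "form (Y l) (D k) (D k') = 0" "form (D k) (D k') (D k'') = 0"
  unfolding form_expand X_def Y_def D_def by (auto intro!: sum.neutral)

text \<open>Only the two rows with label \<open>k\<close> contribute. The square of
  \<open>q1 k\<close> is the bicharacter at (k, k), which merges with the entry of
  \<open>X g\<close>.\<close>

lemma form_XDD:
  assumes "k \<in> two_torsion - {0}"
  shows "form (X g) (D k) (D k') = of_bool (k = k') * (4 * c\<^sup>2 * bichar q1 (k + g) k)"
proof -
  have "X g (Ix_K x \<epsilon>) * D k (Ix_K x \<epsilon>) * D k' (Ix_K x \<epsilon>) =
      (if x = k then a * of_bool (k = k') * c\<^sup>2 * bichar q1 (k + g) k else 0)"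
    if "\<epsilon> \<in> {1, -1}" for x \<epsilon>
    using that by (auto simp: X_def D_def power2_eq_square G.e_add_left G.e_self)
  note val = this[of 1] this[of "- 1"]
  have s: "(\<Sum>x\<in>two_torsion - {0}. X g (Ix_K x 1) * D k (Ix_K x 1) * D k' (Ix_K x 1) +
      X g (Ix_K x (- 1)) * D k (Ix_K x (- 1)) * D k' (Ix_K x (- 1))) =
    (\<Sum>x\<in>two_torsion - {0}. if x = k then 2 * a * of_bool (k = k') * c\<^sup>2 * bichar q1 (k + g) k else 0)"
    by (rule sum.cong) (simp_all add: val)
  have "D k Ix_0 = 0" "D k Ix_pi = 0" "D k (Ix_G h) = 0" "D k (Ix_\<Gamma> \<gamma>) = 0" for h \<gamma>
    by (simp_all add: D_def)
  then have "form (X g) (D k) (D k') =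
    2 / a * (\<Sum>x\<in>two_torsion - {0}. if x = k then 2 * a * of_bool (k = k') * c\<^sup>2 * bichar q1 (k + g) k else 0)"
    unfolding form_expand s by simp
  also have "\<dots> = of_bool (k = k') * (4 * c\<^sup>2 * bichar q1 (k + g) k)"
    using assms ab_nonzero(1) by (simp add: field_simps)
  finally show ?thesis .
qed

end

section \<open>Integrality\<close>

lemma torsion_minus: "k \<in> two_torsion \<Longrightarrow> - k = k"
  by (simp add: two_torsion_def add_eq_0_iff)

lemma torsion_add: "k \<in> two_torsion \<Longrightarrow> k' \<in> two_torsion \<Longrightarrow> k + k' \<in> two_torsion"
  unfolding two_torsion_def by (simp add: algebra_simps)

lemma torsion_diff: "k \<in> two_torsion \<Longrightarrow> g - k = g + k"
  using torsion_minus[of k] by (metis add_uminus_conv_diff)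

lemma sign_count_torsion:
  assumes "k' \<in> two_torsion" "k'' \<in> two_torsion"
  shows "sign_count k k' k'' = 4 * of_bool (k + k' + k'' = 0)"
  by (simp add: sign_count_def torsion_diff assms)

lemma torsion_sum_zero_iff: "k' \<in> two_torsion \<Longrightarrow> k + k' = 0 \<longleftrightarrow> k = k'"
  using torsion_minus[of k'] by (metis add_eq_0_iff2)

lemma sign_count_zero:
  "sign_count 0 g h = 2 * (of_bool (g + h = 0) + of_bool (g = h))" for g h :: "'a :: ab_group_add"
proof -
  have "- g + h = 0 \<longleftrightarrow> g = h" "- g - h = 0 \<longleftrightarrow> g + h = 0"
    by (auto simp: add_eq_0_iff algebra_simps neg_eq_iff_add_eq_0)
  then show ?thesis by (simp add: sign_count_def)
qed

text \<open>Negation fixes \<open>k\<close> and matches the four signed sums in pairs, so the count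
  is even; this absorbs the factor 1/2 of the columns labelled by the 2-torsion.\<close>

lemma sign_count_torsion_left:
  assumes "k \<in> two_torsion"
  shows "sign_count k g h = 2 * (of_bool (k + g + h = 0) + of_bool (k + g - h = 0))"
proof -
  have n: "- (k - u) = k + u" "- (k + u) = k - u" for u
  proof -
    have "- (k - u) = - k + u" "- (k + u) = - k - u" by simp_all
    then show "- (k - u) = k + u" "- (k + u) = k - u" unfolding torsion_minus[OF assms] .
  qed
  have z: "k - u = 0 \<longleftrightarrow> k + u = 0" for u
    using neg_equal_0_iff_equal[of "k - u"] unfolding n(1) by (rule sym)
  have "k - g + h = k - (g - h)" "k - g - h = k - (g + h)"
    "k + g - h = k + (g - h)" "k + g + h = k + (g + h)"
    by (simp_all add: algebra_simps)
  then have "k - g + h = 0 \<longleftrightarrow> k + g - h = 0" "k - g - h = 0 \<longleftrightarrow> k + g + h = 0"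
    by (simp_all only: z)
  then show ?thesis by (simp add: sign_count_def)
qed

lemma sign_count_torsion_two:
  assumes "k \<in> two_torsion" "k' \<in> two_torsion" "g \<notin> two_torsion"
  shows "sign_count k k' g = 0"
proof -
  have m: "k + k' \<in> two_torsion" using assms torsion_add by blast
  have "k + k' + g \<noteq> 0" "k + k' - g \<noteq> 0"
    using m assms(3) torsion_minus[OF m] by (metis add_eq_0_iff, metis right_minus_eq)
  then show ?thesis by (simp add: sign_count_torsion_left[OF assms(1)] add.assoc)
qed

text \<open>The bound by 4 makes the values of \<open>form\<close> on three columns \<open>Y\<close>
  non-negative when \<open>ratio\<close> is 4.\<close>

lemma sign_count_nat: "sign_count g h l \<in> \<nat>" "4 - sign_count g h l \<in> \<nat>"
  by (simp_all add: sign_count_def of_bool_def)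

section \<open>Consequences of integrality, and the converse by cases\<close>

context metric_group_pair
begin

text \<open>All orders of the arguments are listed so that, after trilinear expansion, rewriting
  evaluates every term.\<close>

lemma form_values:
  "form (X g) (X h) (X l) = ratio + sign_count g h l"
  "form (X g) (X h) (Y y) = ratio" "form (X g) (Y y) (X h) = ratio" "form (Y y) (X g) (X h) = ratio"
  "form (X g) (Y y) (Y y') = ratio" "form (Y y) (X g) (Y y') = ratio" "form (Y y) (Y y') (X g) = ratio"
  "form (Y y) (Y y') (Y y'') = ratio - sign_count y y' y''"
  "form (X g) (X h) (D k) = 0" "form (X g) (D k) (X h) = 0" "form (D k) (X g) (X h) = 0"
  "form (X g) (Y y) (D k) = 0" "form (X g) (D k) (Y y) = 0" "form (D k) (X g) (Y y) = 0"
  "form (Y y) (X g) (D k) = 0" "form (Y y) (D k) (X g) = 0" "form (D k) (Y y) (X g) = 0"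
  "form (Y y) (Y y') (D k) = 0" "form (Y y) (D k) (Y y') = 0" "form (D k) (Y y) (Y y') = 0"
  "form (Y y) (D k) (D k') = 0" "form (D k) (Y y) (D k') = 0" "form (D k) (D k') (Y y) = 0"
  "form (D k) (D k') (D k'') = 0"
  using form_XXX form_XXY form_XYY form_YYY form_D_single by (metis form_swap)+

lemma form_XDD_permuted:
  assumes "k \<in> two_torsion - {0}"
  shows "form (X g) (D k) (D k') = of_bool (k = k') * (4 * c\<^sup>2 * bichar q1 (k + g) k)"
    "form (D k) (X g) (D k') = of_bool (k = k') * (4 * c\<^sup>2 * bichar q1 (k + g) k)"
    "form (D k) (D k') (X g) = of_bool (k = k') * (4 * c\<^sup>2 * bichar q1 (k + g) k)"
  using form_XDD[OF assms] by (metis form_swap)+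

lemma two_torsion_nontrivial: "two_torsion - {0 :: 'g} \<noteq> {}"
proof -
  have "even (card (two_torsion :: 'g set))"
    using half_system_card[OF half_systems(1)] card_parity(1) by presburger
  moreover have "card (two_torsion :: 'g set) = Suc (card (two_torsion - {0 :: 'g}))"
    by (intro card.remove) (simp_all add: two_torsion_def)
  ultimately show ?thesis by force
qed

lemma index_set_mem:
  "Ix_0 \<in> J" "Ix_pi \<in> J" "k \<in> two_torsion - {0} \<Longrightarrow> \<epsilon> \<in> {1, - 1} \<Longrightarrow> Ix_K k \<epsilon> \<in> J"
  unfolding index_set_def by auto

text \<open>Of the eight terms of the expansion only the one without \<open>D\<close> and the three
  with exactly two factors \<open>D\<close> survive.\<close>

lemma N_KKK:
  fixes k k' k'' :: 'g
  assumes k: "k \<in> two_torsion - {0}" "k' \<in> two_torsion - {0}" "k'' \<in> two_torsion - {0}"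
    and s: "\<epsilon> \<in> {1, - 1}" "\<epsilon>' \<in> {1, - 1}" "\<epsilon>'' \<in> {1, - 1}"
  shows "N_coeff J S Ix_0 (Ix_K k \<epsilon>) (Ix_K k' \<epsilon>') (Ix_K k'' \<epsilon>'') =
    (ratio + 4 * of_bool (k + k' + k'' = 0) + 4 * c\<^sup>2 *
      (of_int (\<epsilon> * \<epsilon>') * of_bool (k = k') * bichar q1 (k + k'') k +
       of_int (\<epsilon> * \<epsilon>'') * of_bool (k = k'') * bichar q1 (k + k') k +
       of_int (\<epsilon>' * \<epsilon>'') * of_bool (k' = k'') * bichar q1 (k' + k) k')) / 8"
  using N_coeff_form[of "Ix_K k \<epsilon>" "Ix_K k' \<epsilon>'" "Ix_K k'' \<epsilon>''"] k s
  by (simp add: index_set_mem column_def form_comb form_values form_XDD_permuted sign_count_torsion algebra_simps)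

text \<open>One nonzero 2-torsion element with signs (1,1,1) and (1,1,-1) determines both the
  difference d of the orders and c^2; triples of distinct elements then give the last claim.\<close>

lemma integral_fusion_imp:
  assumes nat: "\<forall>i\<in>J. \<forall>j\<in>J. \<forall>k\<in>J. N_coeff J S Ix_0 i j k \<in> \<nat>"
  shows "CARD('h) = CARD('g) + 1" "c\<^sup>2 = 1"
    "\<And>k k' k'' :: 'g. k \<in> two_torsion - {0} \<Longrightarrow> k' \<in> two_torsion - {0} \<Longrightarrow> k'' \<in> two_torsion - {0} \<Longrightarrow>
      k \<noteq> k' \<Longrightarrow> k \<noteq> k'' \<Longrightarrow> k' \<noteq> k'' \<Longrightarrow> k + k' + k'' = 0"
proof -
  obtain k :: 'g where k: "k \<in> two_torsion - {0}" using two_torsion_nontrivial by blast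
  then have kk: "k + k = 0" by (simp add: two_torsion_def)
  have "N_coeff J S Ix_0 (Ix_K k 1) (Ix_K k 1) (Ix_K k \<epsilon>) \<in> \<nat>" if "\<epsilon> \<in> {1, - 1}" for \<epsilon>
    using nat index_set_mem(3)[OF k] that by blast
  from this[of 1] this[of "- 1"] obtain p q :: nat where
    p: "(ratio + 12 * c\<^sup>2) / 8 = of_nat p" and q: "(ratio - 4 * c\<^sup>2) / 8 = of_nat q"
    using k by (auto simp: N_KKK[OF k k k] kk elim!: Nats_cases)
  define d where "d = int CARD('h) - int CARD('g)"
  have "d \<noteq> 0" "odd d" using card_parity by (auto simp: d_def)
  have p': "ratio + 12 * c\<^sup>2 = 8 * of_nat p" and q': "ratio - 4 * c\<^sup>2 = 8 * of_nat q"
    using p q by simp_all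
  \<comment> \<open>This combination eliminates c^2. With \<open>ratio\<close> = 4/d it yields d (p
    + 3 q) = 2, so the odd number d must be 1.\<close>
  have "4 * ratio = (ratio + 12 * c\<^sup>2) + 3 * (ratio - 4 * c\<^sup>2)" by (simp add: algebra_simps)
  then have "4 * ratio = 4 * (2 * of_nat (p + 3 * q))" unfolding p' q' by simp
  then have r: "ratio = 2 * of_nat (p + 3 * q)" by (simp only: mult_cancel_left) simp
  have rd: "ratio = 4 / of_int d" by (simp add: ratio_def d_def)
  have "2 * of_int (d * int (p + 3 * q)) = of_int d * ratio"
    unfolding r by (simp add: algebra_simps)
  also have "\<dots> = 2 * (of_int 2 :: complex)" unfolding rd using \<open>d \<noteq> 0\<close> by simp
  finally have "of_int (d * int (p + 3 * q)) = (of_int 2 :: complex)"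
    by (simp only: mult_cancel_left) simp
  then have d2: "d * int (p + 3 * q) = 2" by (simp only: of_int_eq_iff)
  have "d dvd 2" unfolding d2[symmetric] by (rule dvd_triv_left)
  then have "d \<le> 2" by (rule zdvd_imp_le) simp
  moreover have "d > 0"
  proof (rule ccontr)
    assume "\<not> d > 0"
    then have "d * int (p + 3 * q) \<le> 0" by (intro mult_nonpos_nonneg) simp_all
    then show False using d2 by linarith
  qed
  ultimately have "d = 1" using \<open>odd d\<close> by presburger
  then show 1: "CARD('h) = CARD('g) + 1" by (simp add: d_def)
  have "int (p + 3 * q) = 2" using d2 unfolding \<open>d = 1\<close> by (simp only: mult_1)
  then have "p = 2 \<and> q = 0" by presburger
  then show c: "c\<^sup>2 = 1" using p q by simp
  have r: "ratio = 4" by (simp add: ratio_def 1)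
  show "k + k' + k'' = 0" if k: "k \<in> two_torsion - {0}" "k' \<in> two_torsion - {0}" "k'' \<in> two_torsion - {0}"
    and ne: "k \<noteq> k'" "k \<noteq> k''" "k' \<noteq> k''" for k k' k'' :: 'g
  proof (rule ccontr)
    assume "k + k' + k'' \<noteq> 0"
    \<comment> \<open>For distinct labels all \<open>D\<close> terms vanish, and only
      \<open>ratio\<close> / 8 is left.\<close>
    then have "N_coeff J S Ix_0 (Ix_K k 1) (Ix_K k' 1) (Ix_K k'' 1) = 1 / 2"
      using N_KKK[OF k, of 1 1 1] ne r by simp
    moreover have "N_coeff J S Ix_0 (Ix_K k 1) (Ix_K k' 1) (Ix_K k'' 1) \<in> \<nat>"
      using nat k index_set_mem(3) by blast
    ultimately obtain m :: nat where "1 / 2 = (of_nat m :: complex)" by (auto elim: Nats_cases)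
    then have "of_nat (2 * m) = (of_nat 1 :: complex)" by (simp add: mult.commute)
    then have "2 * m = 1" by (simp only: of_nat_eq_iff)
    then show False by presburger
  qed
qed

text \<open>The columns of S by kind; symmetry of the form leaves the 20 triples of kinds in increasing order.\<close>

definition column_class :: "nat \<Rightarrow> (('g, 'h) index \<Rightarrow> complex) set" where
  "column_class t = [{comb (1/2) (X 0) (of_int \<epsilon> / 2) (Y 0) |\<epsilon>. \<epsilon> \<in> {1, - 1}},
     {comb (1/2) (X k) (of_int \<epsilon> / 2) (D k) |k \<epsilon>. k \<in> two_torsion - {0} \<and> \<epsilon> \<in> {1, - 1}}, X ` Gs, Y ` Hs] ! t"

lemma column_classes:
  "column_class 0 = {comb (1/2) (X 0) (of_int \<epsilon> / 2) (Y 0) |\<epsilon>. \<epsilon> \<in> {1, - 1}}"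
  "column_class 1 = {comb (1/2) (X k) (of_int \<epsilon> / 2) (D k) |k \<epsilon>. k \<in> two_torsion - {0} \<and> \<epsilon> \<in> {1, - 1}}"
  "column_class 2 = X ` Gs" "column_class 3 = Y ` Hs"
  by (simp_all add: column_class_def)

lemma column_in_class:
  assumes "i \<in> J"
  shows "\<exists>t<4. column i \<in> column_class t"
proof (cases i)
  case Ix_0
  then have "column i \<in> column_class 0" unfolding column_classes column_def by (auto intro!: exI[of _ "- 1"])
  then show ?thesis by (intro exI[of _ 0]) simp
next
  case Ix_pi
  then have "column i \<in> column_class 0" unfolding column_classes column_def by (auto intro!: exI[of _ 1])
  then show ?thesis by (intro exI[of _ 0]) simp
next
  case (Ix_K k \<epsilon>)
  then have "column i \<in> column_class 1"
    using assms unfolding column_classes column_def index_set_def by auto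
  then show ?thesis by (intro exI[of _ 1]) simp
next
  case (Ix_G g)
  then have "column i \<in> column_class 2"
    using assms unfolding column_classes column_def index_set_def by auto
  then show ?thesis by (intro exI[of _ 2]) simp
next
  case (Ix_\<Gamma> \<gamma>)
  then have "column i \<in> column_class 3"
    using assms unfolding column_classes column_def index_set_def by auto
  then show ?thesis by (intro exI[of _ 3]) simp
qed

lemma Gs_not_torsion:
  assumes "g \<in> Gs"
  shows "g \<notin> two_torsion"
  using half_system_notin(1)[OF half_systems(1) assms] .

lemma form_in_Nats:
  assumes r: "ratio = 4" and c: "c\<^sup>2 = 1"
    and K: "\<And>k k' k''. k \<in> two_torsion - {0 :: 'g} \<Longrightarrow> k' \<in> two_torsion - {0} \<Longrightarrow> k'' \<in> two_torsion - {0} \<Longrightarrow>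
      k \<noteq> k' \<Longrightarrow> k \<noteq> k'' \<Longrightarrow> k' \<noteq> k'' \<Longrightarrow> k + k' + k'' = 0"
    and le: "s \<le> t" "t \<le> t'" "t' < 4"
    and mem: "u \<in> column_class s" "v \<in> column_class t" "w \<in> column_class t'"
  shows "form u v w \<in> \<nat>"
proof -
  have ZZZ: "form (comb (1/2) (X 0) (of_int \<epsilon> / 2) (Y 0)) (comb (1/2) (X 0) (of_int \<epsilon>' / 2) (Y 0)) (comb (1/2) (X 0) (of_int \<epsilon>'' / 2) (Y 0)) \<in> \<nat>"
    if "\<epsilon> \<in> {1, - 1}" "\<epsilon>' \<in> {1, - 1}" "\<epsilon>'' \<in> {1, - 1}" for \<epsilon> \<epsilon>' \<epsilon>'' :: int
    using that by (auto simp: form_comb form_values r sign_count_def)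
  have ekk: "bichar q1 (k + g) k = 1 \<or> bichar q1 (k + g) k = - 1" if "k \<in> two_torsion" for k g
    using G.e_torsion_cases[OF that] by (metis G.e_commute)
  have zero_mem: "0 \<in> two_torsion" by (simp add: two_torsion_def)
  note eval = form_comb form_values r c
  have "s < 4" "t < 4" using le by linarith+
  then have cases: "s = 0 \<or> s = 1 \<or> s = 2 \<or> s = 3" "t = 0 \<or> t = 1 \<or> t = 2 \<or> t = 3"
    "t' = 0 \<or> t' = 1 \<or> t' = 2 \<or> t' = 3" using le by linarith+
  consider "s = 0" "t = 0" "t' = 0" | "s = 0" "t = 0" "t' = 1" | "s = 0" "t = 0" "t' = 2" | "s = 0" "t = 0" "t' = 3"
    | "s = 0" "t = 1" "t' = 1" | "s = 0" "t = 1" "t' = 2" | "s = 0" "t = 1" "t' = 3"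
    | "s = 0" "t = 2" "t' = 2" | "s = 0" "t = 2" "t' = 3" | "s = 0" "t = 3" "t' = 3"
    | "s = 1" "t = 1" "t' = 1" | "s = 1" "t = 1" "t' = 2" | "s = 1" "t = 1" "t' = 3"
    | "s = 1" "t = 2" "t' = 2" | "s = 1" "t = 2" "t' = 3" | "s = 1" "t = 3" "t' = 3"
    | "s = 2" "t = 2" "t' = 2" | "s = 2" "t = 2" "t' = 3" | "s = 2" "t = 3" "t' = 3" | "s = 3" "t = 3" "t' = 3"
    using cases le by (elim disjE) auto
  then show ?thesis
  proof cases
    case 1
    show ?thesis using mem unfolding 1 column_classes by (auto intro: ZZZ)
  next
    case 2
    show ?thesis using mem unfolding 2 column_classes
      by (auto simp: eval sign_count_zero)
  next
    case 3
    have "w \<in> X ` Gs" using mem(3) unfolding 3 column_classes .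
    then obtain g where g: "w = X g" "g \<notin> two_torsion" using Gs_not_torsion by blast
    then have "g \<noteq> 0" using zero_mem by blast
    then show ?thesis using mem(1,2) unfolding 3 column_classes
      by (auto simp: g(1) eval sign_count_zero)
  next
    case 4
    have "w \<in> Y ` Hs" using mem(3) unfolding 4 column_classes .
    then obtain y where y: "w = Y y" "y \<noteq> 0" using half_system_notin(1)[OF half_systems(2)] by blast
    show ?thesis using mem(1,2) y(2) unfolding 4 column_classes
      by (auto simp: y(1) eval sign_count_zero)
  next
    case 5
    obtain \<epsilon> k \<epsilon>' k' \<epsilon>'' where uvw: "u = comb (1/2) (X 0) (of_int \<epsilon> / 2) (Y 0)"
      "v = comb (1/2) (X k) (of_int \<epsilon>' / 2) (D k)" "w = comb (1/2) (X k') (of_int \<epsilon>'' / 2) (D k')"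
      and k: "k \<in> two_torsion - {0}" "k' \<in> two_torsion - {0}" and e: "\<epsilon> \<in> {1, - 1}" "\<epsilon>' \<in> {1, - 1}" "\<epsilon>'' \<in> {1, - 1}"
      using mem unfolding 5 column_classes by blast
    have "k + k' = 0 \<longleftrightarrow> k = k'" using torsion_sum_zero_iff k(2) by blast
    \<comment> \<open>Both 4 + 4 \<epsilon> and the factor multiplying the indicator are 0 or
      8.\<close>
    then have f: "form u v w = (4 + 4 * of_int \<epsilon> + of_bool (k = k') * (4 + 4 * of_int (\<epsilon>' * \<epsilon>'') * bichar q1 k k)) / 8"
      unfolding uvw by (simp add: eval form_XDD_permuted[OF k(1)] sign_count_zero algebra_simps)
    show ?thesis unfolding f using e ekk[of k 0] k by (auto simp: of_bool_def)
  next
    case 6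
    obtain \<epsilon> k \<epsilon>' g where uvw: "u = comb (1/2) (X 0) (of_int \<epsilon> / 2) (Y 0)"
      "v = comb (1/2) (X k) (of_int \<epsilon>' / 2) (D k)" "w = X g"
      and k: "k \<in> two_torsion - {0}" "g \<notin> two_torsion" and e: "\<epsilon> \<in> {1, - 1}" "\<epsilon>' \<in> {1, - 1}"
      using mem Gs_not_torsion unfolding 6 column_classes by blast
    have "sign_count 0 k g = 0" using sign_count_torsion_two[OF zero_mem] k by blast
    then show ?thesis using e unfolding uvw by (auto simp: eval)
  next
    case 7
    show ?thesis using mem unfolding 7 column_classes by (auto simp: eval)
  next
    case 8
    show ?thesis using mem unfolding 8 column_classes
      by (auto simp: eval sign_count_zero of_bool_def)
  next
    case 9
    show ?thesis using mem unfolding 9 column_classes by (auto simp: eval)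
  next
    case 10
    show ?thesis using mem unfolding 10 column_classes
      by (auto simp: eval sign_count_zero of_bool_def)
  next
    case 11
    obtain k \<epsilon> k' \<epsilon>' k'' \<epsilon>'' where uvw: "u = column (Ix_K k \<epsilon>)" "v = column (Ix_K k' \<epsilon>')" "w = column (Ix_K k'' \<epsilon>'')"
      and k: "k \<in> two_torsion - {0}" "k' \<in> two_torsion - {0}" "k'' \<in> two_torsion - {0}"
      and e: "\<epsilon> \<in> {1, - 1}" "\<epsilon>' \<in> {1, - 1}" "\<epsilon>'' \<in> {1, - 1}"
      using mem unfolding 11 column_classes column_def by (simp only: index.case) blast
    have f: "form u v w = (ratio + 4 * of_bool (k + k' + k'' = 0) + 4 * c\<^sup>2 *
      (of_int (\<epsilon> * \<epsilon>') * of_bool (k = k') * bichar q1 (k + k'') k +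
       of_int (\<epsilon> * \<epsilon>'') * of_bool (k = k'') * bichar q1 (k + k') k +
       of_int (\<epsilon>' * \<epsilon>'') * of_bool (k' = k'') * bichar q1 (k' + k) k')) / 8"
      using N_KKK[OF k e] N_coeff_form index_set_mem(3) k e unfolding uvw by metis
    have z: "k + k = 0" "k' + k' = 0" "k'' + k'' = 0" using k by (auto simp: two_torsion_def)
    have z': "k + k' + k = k'" "k' + k + k = k'" "k + k' + k' = k" using z by (simp_all add: algebra_simps flip: add.assoc)
    have ek: "bichar q1 (k + k'') k = 1 \<or> bichar q1 (k + k'') k = - 1"
      "bichar q1 (k + k') k = 1 \<or> bichar q1 (k + k') k = - 1"
      "bichar q1 (k' + k) k' = 1 \<or> bichar q1 (k' + k) k' = - 1"
      using ekk k by blast+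
    \<comment> \<open>If all labels agree, the sign products add up to 3 or -1. If exactly two
      agree, a single term 4 or -4 is added to \<open>ratio\<close> = 4. If all differ, the
      assumption \<open>K\<close> supplies the second 4 of the numerator 8.\<close>
    consider "k = k'" "k = k''" | "k = k'" "k \<noteq> k''" | "k \<noteq> k'" "k = k''" | "k \<noteq> k'" "k' = k''" | "k \<noteq> k'" "k \<noteq> k''" "k' \<noteq> k''"
      by blast
    then show ?thesis
    proof cases
      case 1
      then show ?thesis unfolding f using e z k by (auto simp: r c)
    next
      case 2
      then show ?thesis unfolding f using e z k ek(1) by (auto simp: r c)
    next
      case 3
      have "k + k' + k'' \<noteq> 0" unfolding 3(2)[symmetric] z'(1) using k(2) by simp
      then show ?thesis unfolding f using 3 e k ek(2) by (auto simp: r c)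
    next
      case 4
      have "k + k' + k'' \<noteq> 0" unfolding 4(2)[symmetric] z'(3) using k(1) by simp
      then show ?thesis unfolding f using 4 e k ek(3) by (auto simp: r c)
    next
      case 5
      then show ?thesis unfolding f using K[OF k] by (simp add: r)
    qed
  next
    case 12
    obtain k \<epsilon> k' \<epsilon>' g where uvw: "u = comb (1/2) (X k) (of_int \<epsilon> / 2) (D k)"
      "v = comb (1/2) (X k') (of_int \<epsilon>' / 2) (D k')" "w = X g"
      and k: "k \<in> two_torsion - {0}" "k' \<in> two_torsion - {0}" "g \<notin> two_torsion" and e: "\<epsilon> \<in> {1, - 1}" "\<epsilon>' \<in> {1, - 1}"
      using mem Gs_not_torsion unfolding 12 column_classes by blast
    have "sign_count k k' g = 0" using sign_count_torsion_two k by blast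
    then have f: "form u v w = (4 + 4 * of_bool (k = k') * of_int (\<epsilon> * \<epsilon>') * bichar q1 (k + g) k) / 4"
      unfolding uvw by (simp add: eval form_XDD_permuted[OF k(1)])
    show ?thesis unfolding f using e ekk[of k g] k by (auto simp: of_bool_def)
  next
    case 13
    show ?thesis using mem unfolding 13 column_classes by (auto simp: eval)
  next
    case 14
    show ?thesis using mem unfolding 14 column_classes
      by (auto simp: eval sign_count_torsion_left of_bool_def)
  next
    case 15
    show ?thesis using mem unfolding 15 column_classes by (auto simp: eval)
  next
    case 16
    show ?thesis using mem unfolding 16 column_classes by (auto simp: eval)
  next
    case 17
    show ?thesis using mem unfolding 17 column_classes by (auto simp: eval sign_count_nat)
  next
    case 18
    show ?thesis using mem unfolding 18 column_classes by (auto simp: eval)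
  next
    case 19
    show ?thesis using mem unfolding 19 column_classes by (auto simp: eval)
  next
    case 20
    show ?thesis using mem unfolding 20 column_classes by (auto simp: eval sign_count_nat)
  qed
qed

end

section \<open>The Klein four-group and the conclusion\<close>

lemma klein_four_map:
  fixes k k' :: "'g :: {finite, ab_group_add}"
  assumes T: "two_torsion = {0, k, k', k + k'}" and k: "k \<noteq> 0" "k' \<noteq> 0" "k \<noteq> k'"
  shows "\<exists>f :: 'g \<Rightarrow> 2 \<times> 2. bij_betw f two_torsion UNIV \<and>
    (\<forall>x \<in> two_torsion. \<forall>y \<in> two_torsion. f (x + y) = f x + f y)"
proof -
  have "k \<in> two_torsion" "k' \<in> two_torsion" unfolding T by simp_all
  then have z: "k + k = 0" "k' + k' = 0" by (simp_all add: two_torsion_def)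
  have z': "k + (k + u) = u" "k' + (k' + u) = u" for u
    unfolding add.assoc[symmetric] z by simp_all
  have c: "k' + (k + u) = k + (k' + u)" "k' + k = k + k'" for u
    by (rule add.left_commute, rule add.commute)
  have ne: "k + k' \<noteq> 0" "k + k' \<noteq> k" "k + k' \<noteq> k'"
    using z k by (metis add_left_cancel, simp_all)
  \<comment> \<open>The coordinates with respect to the basis \<open>k\<close>, \<open>k'\<close>;
    the type \<open>2\<close> is the ring of integers modulo 2.\<close>
  define f :: "'g \<Rightarrow> 2 \<times> 2" where
    "f x = (of_bool (x = k \<or> x = k + k'), of_bool (x = k' \<or> x = k + k'))" for x
  have f: "f 0 = (0, 0)" "f k = (1, 0)" "f k' = (0, 1)" "f (k + k') = (1, 1)"
    using k ne by (auto simp: f_def)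
  have "inj_on f two_torsion"
    unfolding T inj_on_def by (auto simp: f)
  moreover from this have "f ` two_torsion = UNIV"
    by (intro card_subset_eq) (use k ne in \<open>auto simp: card_image T[THEN arg_cong[of _ _ card]]\<close>)
  moreover have "f (x + y) = f x + f y" if "x \<in> two_torsion" "y \<in> two_torsion" for x y
  proof -
    have "x \<in> {0, k, k', k + k'}" "y \<in> {0, k, k', k + k'}" using that unfolding T by blast+
    then show ?thesis by (elim insertE emptyE) (simp_all add: f z z' c add.assoc)
  qed
  ultimately show ?thesis unfolding bij_betw_def by blast
qed

text \<open>If \<open>k''\<close> were not \<open>k + k'\<close>, then 0, \<open>k\<close>,
  \<open>k'\<close>, \<open>k''\<close>, \<open>k + k'\<close> would be five distinct elements of
  the 2-torsion.\<close>

lemma sum_of_card_four_torsion: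
  fixes k :: "'g :: {finite, ab_group_add}"
  assumes card: "card (two_torsion :: 'g set) = 4"
    and k: "k \<in> two_torsion - {0}" "k' \<in> two_torsion - {0}" "k'' \<in> two_torsion - {0}"
    and ne: "k \<noteq> k'" "k \<noteq> k''" "k' \<noteq> k''"
  shows "k + k' + k'' = 0"
proof -
  have z: "k + k = 0" "k' + k' = 0" "k'' + k'' = 0" using k by (auto simp: two_torsion_def)
  have s: "k + k' \<in> two_torsion" using z by (simp add: two_torsion_def algebra_simps)
  have s': "k + k' \<noteq> 0" "k + k' \<noteq> k" "k + k' \<noteq> k'"
    using z k ne by (metis add_left_cancel, simp_all)
  have "k + k' = k''"
  proof (rule ccontr)
    assume "k + k' \<noteq> k''"
    then have "card {0, k, k', k'', k + k'} = 5" using s' ne k by auto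
    moreover have "card {0, k, k', k'', k + k'} \<le> card (two_torsion :: 'g set)"
      by (rule card_mono) (use k s in \<open>auto simp: two_torsion_def\<close>)
    ultimately show False using card by simp
  qed
  then show ?thesis using z by simp
qed

text \<open>Consecutive squares are coprime. Explicitly, dividing the hypotheses gives t^(2n+1) = 1;
  raising this to the power 2n leaves t^(2n) = 1, as 4 n^2 is a multiple of n^2.\<close>

lemma eq_one_if_coprime_powers:
  fixes t :: complex and n :: nat
  assumes 1: "t ^ n\<^sup>2 = 1" and 2: "t ^ (n + 1)\<^sup>2 = 1"
  shows "t = 1"
proof -
  have "(n + 1)\<^sup>2 = n\<^sup>2 + (2 * n + 1)" by (simp add: power2_eq_square)
  then have "t ^ (n + 1)\<^sup>2 = t ^ n\<^sup>2 * t ^ (2 * n + 1)" by (simp only: power_add)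
  then have a: "t ^ (2 * n) * t = 1" using 1 2 by (simp add: mult.commute)
  have e: "2 * n * (2 * n) = n\<^sup>2 * 4" by (simp add: power2_eq_square)
  have "(t ^ (2 * n) * t) ^ (2 * n) = (t ^ n\<^sup>2) ^ 4 * t ^ (2 * n)"
    by (simp only: power_mult_distrib power_mult[symmetric] e)
  then have "t ^ (2 * n) = 1" using a 1 by simp
  then show ?thesis using a by simp
qed

theorem theorem6p4:
  fixes q1 :: "'g :: {finite, ab_group_add} \<Rightarrow> complex"
    and q2 :: "'h :: {finite, ab_group_add} \<Rightarrow> complex"
    and c :: complex
    and Gs :: "'g set" and \<Gamma>s :: "'h set"
  assumes "metric_group q1" and "metric_group q2"
    and "even CARD('g)" and "odd CARD('h)"
    and "c = gauss_sum q1" and "gauss_sum q1 = - gauss_sum q2"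
    and "half_system two_torsion Gs" and "half_system {0} \<Gamma>s"
  shows "(\<forall>i \<in> index_set Gs \<Gamma>s. \<forall>j \<in> index_set Gs \<Gamma>s. \<forall>k \<in> index_set Gs \<Gamma>s.
            N_coeff (index_set Gs \<Gamma>s) (S_matrix c q1 q2) Ix_0 i j k \<in> \<nat>)
         \<longleftrightarrow>
         CARD('h) = CARD('g) + 1 \<and>
         (\<exists>f :: 'g \<Rightarrow> 2 \<times> 2.
            bij_betw f two_torsion UNIV \<and>
            (\<forall>x \<in> two_torsion. \<forall>y \<in> two_torsion. f (x + y) = f x + f y))"
    (is "?nat \<longleftrightarrow> ?card \<and> (\<exists>f. ?iso f)")
proof -
  interpret metric_group_pair q1 q2 c Gs \<Gamma>s "1 / complex_of_real (sqrt (real CARD('g)))"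
    "1 / complex_of_real (sqrt (real CARD('h)))"
    by unfold_locales (use assms in simp_all)
  show ?thesis
  proof (intro iffI conjI)
    assume nat: ?nat
    note I = integral_fusion_imp[OF nat]
    show ?card by (rule I(1))
    obtain k :: 'g where k: "k \<in> two_torsion - {0}" using two_torsion_nontrivial by blast
    \<comment> \<open>Exactly one involution would contradict c^2 = 1, by the Gauss sum argument for
      cyclic Sylow 2-subgroups.\<close>
    have "two_torsion \<noteq> {0, k}"
    proof
      assume "two_torsion = {0, k}"
      then interpret single_involution q1 k by unfold_locales (use k in auto)
      show False using gauss_sum_square_not_one[OF assms(7)] I(2) assms(5) by simp
    qed
    moreover have "{0, k} \<subseteq> two_torsion" using k by (auto simp: two_torsion_def)
    ultimately obtain k' where k': "k' \<in> two_torsion" "k' \<noteq> 0" "k' \<noteq> k" by blast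
    have kk: "k + k' \<in> two_torsion" using k k' torsion_add by blast
    have "x \<in> {0, k, k', k + k'}" if "x \<in> two_torsion" for x
    proof (rule ccontr)
      assume x: "x \<notin> {0, k, k', k + k'}"
      then have "k + k' + x = 0" using I(3)[of k k' x] k k' that by blast
      then show False using x that torsion_sum_zero_iff[of x "k + k'"] by blast
    qed
    then have "two_torsion = {0, k, k', k + k'}"
      using kk k k' \<open>{0, k} \<subseteq> two_torsion\<close> by blast
    from klein_four_map[OF this] show "\<exists>f. ?iso f" using k k' by auto
  next
    assume "?card \<and> (\<exists>f. ?iso f)"
    then obtain f :: "'g \<Rightarrow> 2 \<times> 2" where m: ?card and "bij_betw f two_torsion UNIV" by blast
    then have K: "card (two_torsion :: 'g set) = 4"
      using bij_betw_same_card by fastforce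
    have tt: "half_system two_torsion \<Gamma>s"
      using assms(8) half_system_trivial_torsion[OF assms(8)] by simp
    have "CARD('g) = 4 * card (range (nat_mul 2 :: 'g \<Rightarrow> 'g))"
      using card_double_image[where H = "UNIV :: 'g set", OF add_subgroup_UNIV] K by simp
    moreover have "CARD('h) = 1 + 2 * card \<Gamma>s" using half_system_card[OF assms(8)] by simp
    \<comment> \<open>From 2 \<open>card \<Gamma>s\<close> = \<open>CARD('g)\<close>, a multiple of
      4, this half system has even size, as the parity condition for the odd group requires.\<close>
    ultimately have "card \<Gamma>s = 2 * card (range (nat_mul 2 :: 'g \<Rightarrow> 'g))" using m by linarith
    then have "(gauss_sum q2)\<^sup>2 ^ CARD('h)\<^sup>2 = 1"
      by (intro H.gauss_sum_power_card_square[OF tt]) simp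
    \<comment> \<open>The squares of the two Gauss sums agree, so c^2 is a root of unity for the
      squares of two consecutive orders.\<close>
    then have "(c\<^sup>2) ^ (CARD('g) + 1)\<^sup>2 = 1" using assms(5,6) m by simp
    moreover have "(c\<^sup>2) ^ (CARD('g))\<^sup>2 = 1"
      unfolding assms(5) by (intro G.gauss_sum_power_card_square[OF assms(7)]) (simp add: assms(3))
    ultimately have c: "c\<^sup>2 = 1" using eq_one_if_coprime_powers by blast
    have r: "ratio = 4" by (simp add: ratio_def m)
    show ?nat
    proof (intro ballI)
      fix i j k assume ijk: "i \<in> J" "j \<in> J" "k \<in> J"
      obtain s t t' where st: "s < 4" "t < 4" "t' < 4"
        "column i \<in> column_class s" "column j \<in> column_class t" "column k \<in> column_class t'"
        using column_in_class ijk by meson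
      note F = form_in_Nats[OF r c sum_of_card_four_torsion[OF K]]
      consider "s \<le> t" "t \<le> t'" | "s \<le> t'" "t' \<le> t" | "t \<le> s" "s \<le> t'" | "t \<le> t'" "t' \<le> s"
        | "t' \<le> s" "s \<le> t" | "t' \<le> t" "t \<le> s" by linarith
      then have "form (column i) (column j) (column k) \<in> \<nat>"
      proof cases
        case 1 then show ?thesis using F st by blast
      next
        case 2
        then have "form (column i) (column k) (column j) \<in> \<nat>" using F st by blast
        then show ?thesis by (metis form_swap)
      next
        case 3
        then have "form (column j) (column i) (column k) \<in> \<nat>" using F st by blast
        then show ?thesis by (metis form_swap)
      next
        case 4
        then have "form (column j) (column k) (column i) \<in> \<nat>" using F st by blast
        then show ?thesis by (metis form_swap)
      next
        case 5
        then have "form (column k) (column i) (column j) \<in> \<nat>" using F st by blast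
        then show ?thesis by (metis form_swap)
      next
        case 6
        then have "form (column k) (column j) (column i) \<in> \<nat>" using F st by blast
        then show ?thesis by (metis form_swap)
      qed
      then show "N_coeff J S Ix_0 i j k \<in> \<nat>" using N_coeff_form[OF ijk] by simp
    qed
  qed
qed

end
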